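(* Let $F=\phi(r,u,v)$ be a spherically symmetric Finsler metric on a convex domain $\Omega\subset\mathbb{R}^n$, where $r=|x|$, $u=|y|$, $v=\langle x,y\rangle$. Then $F$ is projectively flat and locally dually flat if and only if $$\phi(r,u,v)=\frac{\sqrt{(k-c^2r^2)u^2+c^2v^2}+cv}{k-c^2r^2},$$ where $k$ and $c$ are constants. More precisely, every projectively flat and locally dually flat spherically symmetric Finsler metric is a deformation of the Funk metric.
   Context: $|\cdot|$ and $\langle\cdot,\cdot\rangle$ denote the Euclidean norm and inner product on $\mathbb{R}^n$; $x\in\Omega$ is a point and $y$ a tangent vector at $x$. Subscripts $x^k$, $y^l$ denote partial derivatives, and repeated indices are summed. A Finsler metric on a manifold $M$ is a continuous function $F:TM\to[0,\infty)$ that is $C^\infty$ and positive on the slit tangent bundle $TM_0=TM\setminus\{0\}$, satisfies $F(x,\lambda y)=\lambda F(x,y)$ for $\lambda>0$, and for which the matrix $g_{ij}=\tfrac12[F^2]_{y^iy^j}$ is positive definite on $TM_0$; $(g^{ij})$ is its inverse. The spray coefficients of $F$ in a coordinate system $(x^i)$ (with induced fibre coordinates $y^i$) are $$G^i=\tfrac14 g^{il}\big([F^2]_{x^ky^l}y^k-[F^2]_{x^l}\big).$$ $F$ is spherically symmetric on $\Omega$ if it is invariant under any rotation in $\mathbb{R}^n$; equivalently, there is a positive function $\phi=\phi(r,u,v)$ with $F(x,y)=\phi(|x|,|y|,\langle x,y\rangle)$. $F$ is projectively flat on an open subset of $\mathbb{R}^n$ if its geodesics are straight lines as point sets; equivalently,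 in the standard coordinates, $F_{x^ky^l}y^k=F_{x^l}$ for all $l$. $F$ is locally dually flat if at any point there is a coordinate system $(x^i)$ in which the spray coefficients have the form $G^i=-\tfrac12 g^{ij}H_{y^j}$, where $H=H(x,y)$ is a $C^\infty$ homogeneous scalar function on $TM_0$. The Funk metric is the metric $$F(x,y)=\frac{\sqrt{|y|^2-(|x|^2|y|^2-\langle x,y\rangle^2)}+\langle x,y\rangle}{1-|x|^2}$$ on the unit ball of $\mathbb{R}^n$; it is the case $k=c=1$ of the displayed family. "Deformation of the Funk metric" is used informally, without a further definition, for the members of this family.
   Formalization: Locally dually flat is taken in the standard coordinates of R^n, since with arbitrary coordinate systems the Klein metric is a counterexample; and n ≥ 2 is assumed, since for n = 1 both flatness conditions always hold and e.g. (1+x^2)|y| is a counterexample. *)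

theory Defs
  imports "HOL-Analysis.Analysis"
begin

text \<open>
  A function \<open>F\<close> on the tangent bundle of an open set \<open>\<Omega>\<close> is written \<open>F x y\<close> with point \<open>x\<close> and
  tangent vector \<open>y\<close>, in the standard coordinates. Only its values at \<open>x \<in> \<Omega>\<close> matter.
\<close>

text \<open>Continuous differentiability of order \<open>k\<close> on an open set, by iterated directional derivatives.\<close>

fun Ck_on :: "nat \<Rightarrow> ('a::euclidean_space \<Rightarrow> real) \<Rightarrow> 'a set \<Rightarrow> bool" where
  "Ck_on 0 f S \<longleftrightarrow> continuous_on S f"
| "Ck_on (Suc k) f S \<longleftrightarrow> (\<forall>z\<in>S. f differentiable (at z)) \<and>
     (\<forall>v. Ck_on k (\<lambda>z. frechet_derivative f (at z) v) S)"

definition smooth_on :: "('a::euclidean_space \<Rightarrow> real) \<Rightarrow> 'a set \<Rightarrow> bool" where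
  "smooth_on f S \<longleftrightarrow> (\<forall>k. Ck_on k f S)"

definition slit :: "'a::euclidean_space set \<Rightarrow> ('a \<times> 'a) set" where
  "slit \<Omega> = \<Omega> \<times> (- {0})"

text \<open>Partial derivatives with respect to \<open>x\<^sup>i\<close> and \<open>y\<^sup>i\<close>.\<close>

definition Dx :: "'n::finite \<Rightarrow> (real^'n \<Rightarrow> real^'n \<Rightarrow> real) \<Rightarrow> real^'n \<Rightarrow> real^'n \<Rightarrow> real" where
  "Dx i f x y = deriv (\<lambda>t. f (x + t *\<^sub>R axis i 1) y) 0"

definition Dy :: "'n::finite \<Rightarrow> (real^'n \<Rightarrow> real^'n \<Rightarrow> real) \<Rightarrow> real^'n \<Rightarrow> real^'n \<Rightarrow> real" where
  "Dy i f x y = deriv (\<lambda>t. f x (y + t *\<^sub>R axis i 1)) 0"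

definition sq :: "('a \<Rightarrow> 'a \<Rightarrow> real) \<Rightarrow> 'a \<Rightarrow> 'a \<Rightarrow> real" where
  "sq F x y = (F x y)\<^sup>2"

definition fundamental_tensor ::
    "(real^'n \<Rightarrow> real^'n \<Rightarrow> real) \<Rightarrow> real^'n \<Rightarrow> real^'n \<Rightarrow> real^'n^'n::finite" where
  "fundamental_tensor F x y = (\<chi> i j. 1/2 * Dy j (Dy i (sq F)) x y)"

definition finsler_metric_on ::
    "(real^'n::finite) set \<Rightarrow> (real^'n \<Rightarrow> real^'n \<Rightarrow> real) \<Rightarrow> bool" where
  "finsler_metric_on \<Omega> F \<longleftrightarrow>
     continuous_on (\<Omega> \<times> UNIV) (\<lambda>(x, y). F x y) \<and>
     (\<forall>x\<in>\<Omega>. \<forall>y. 0 \<le> F x y) \<and>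
     smooth_on (\<lambda>(x, y). F x y) (slit \<Omega>) \<and>
     (\<forall>x\<in>\<Omega>. \<forall>y. y \<noteq> 0 \<longrightarrow> 0 < F x y) \<and>
     (\<forall>x\<in>\<Omega>. \<forall>y. \<forall>l>0. F x (l *\<^sub>R y) = l * F x y) \<and>
     (\<forall>x\<in>\<Omega>. \<forall>y. y \<noteq> 0 \<longrightarrow>
        (\<forall>w. w \<noteq> 0 \<longrightarrow> 0 < w \<bullet> (fundamental_tensor F x y *v w)))"

definition inv_tensor ::
    "(real^'n \<Rightarrow> real^'n \<Rightarrow> real) \<Rightarrow> real^'n \<Rightarrow> real^'n \<Rightarrow> real^'n^'n::finite" where
  "inv_tensor F x y = matrix_inv (fundamental_tensor F x y)"

definition spray :: "(real^'n::finite \<Rightarrow> real^'n \<Rightarrow> real) \<Rightarrow> real^'n \<Rightarrow> real^'n \<Rightarrow> real^'n" where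
  "spray F x y = (\<chi> i. 1/4 * (\<Sum>l\<in>UNIV. inv_tensor F x y $ i $ l *
      ((\<Sum>k\<in>UNIV. Dy l (Dx k (sq F)) x y * y $ k) - Dx l (sq F) x y)))"

text \<open>
  \<open>F\<close> is invariant under rotations. If \<open>\<Omega>\<close> is not itself rotation invariant, this is required
  whenever both points lie in \<open>\<Omega>\<close>.
\<close>

definition spherically_symmetric_on ::
    "(real^'n::finite) set \<Rightarrow> (real^'n \<Rightarrow> real^'n \<Rightarrow> real) \<Rightarrow> bool" where
  "spherically_symmetric_on \<Omega> F \<longleftrightarrow>
     (\<forall>Q. rotation_matrix Q \<longrightarrow>
        (\<forall>x\<in>\<Omega>. Q *v x \<in> \<Omega> \<longrightarrow> (\<forall>y. F (Q *v x) (Q *v y) = F x y)))"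

text \<open>Regular solutions of \<open>c'' + 2 G(c, c') = 0\<close> on the open interval \<open>(a, b)\<close>.\<close>

definition geodesic_on ::
    "(real^'n::finite) set \<Rightarrow> (real^'n \<Rightarrow> real^'n \<Rightarrow> real) \<Rightarrow> real \<Rightarrow> real \<Rightarrow> (real \<Rightarrow> real^'n) \<Rightarrow> bool"
where
  "geodesic_on \<Omega> F a b c \<longleftrightarrow>
     (\<exists>c'. \<forall>t\<in>{a<..<b}. c t \<in> \<Omega> \<and> c' t \<noteq> 0 \<and>
        (c has_vector_derivative c' t) (at t) \<and>
        (c' has_vector_derivative (- 2 *\<^sub>R spray F (c t) (c' t))) (at t))"

text \<open>
  A geodesic need not be maximal, so its point set is required to lie on a straight line, not to
  fill one.
\<close>

definition projectively_flat_on ::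
    "(real^'n::finite) set \<Rightarrow> (real^'n \<Rightarrow> real^'n \<Rightarrow> real) \<Rightarrow> bool" where
  "projectively_flat_on \<Omega> F \<longleftrightarrow>
     (\<forall>a b c. a < b \<longrightarrow> geodesic_on \<Omega> F a b c \<longrightarrow>
        (\<exists>p v. v \<noteq> 0 \<and> c ` {a<..<b} \<subseteq> range (\<lambda>s. p + s *\<^sub>R v)))"

text \<open>
  Local dual flatness with respect to the standard coordinates of \<open>\<real>\<^sup>n\<close>, i.e. around every point the
  standard coordinates are adapted. Arbitrary curvilinear adapted coordinates are not
  allowed: with those, every Hessian Riemannian metric would qualify, in particular the Klein model
  of hyperbolic space, which is spherically symmetric and projectively flat on the unit ball
  without being of Funk type.
\<close>

definition locally_dually_flat_on ::
    "(real^'n::finite) set \<Rightarrow> (real^'n \<Rightarrow> real^'n \<Rightarrow> real) \<Rightarrow> bool" where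
  "locally_dually_flat_on \<Omega> F \<longleftrightarrow>
     (\<forall>p\<in>\<Omega>. \<exists>U. open U \<and> p \<in> U \<and> U \<subseteq> \<Omega> \<and>
        (\<exists>H d. smooth_on (\<lambda>(x, y). H x y) (slit U) \<and>
           (\<forall>x\<in>U. \<forall>y. y \<noteq> 0 \<longrightarrow> (\<forall>l>0. H x (l *\<^sub>R y) = l powr d * H x y)) \<and>
           (\<forall>x\<in>U. \<forall>y. y \<noteq> 0 \<longrightarrow> (\<forall>i. spray F x y $ i =
              - (1/2) * (\<Sum>j\<in>UNIV. inv_tensor F x y $ i $ j * Dy j H x y)))))"

end

theory Submission
  imports Defs
begin

text \<open>
  Put \<open>L = F\<^sup>2\<close>. Existence of geodesics turns projective flatness into \<open>G = P y\<close>. Together with dual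
  flatness this gives \<open>F\<^sub>x = c F F\<^sub>y\<close>, where \<open>c\<close> does not depend on \<open>y\<close>. Infinitesimal rotation
  invariance then forces \<open>F\<^sub>y\<close> to be parallel to \<open>y + c F x\<close>, so that
  \<open>W = (norm (y / F + c x))\<^sup>2\<close> has vanishing \<open>y\<close>-derivative, while its \<open>x\<close>-derivative is
  \<open>2 (x \<bullet> y / F + c (norm x)\<^sup>2) dc\<close>. Comparing \<open>y \<bottom> x\<close> with \<open>y = x\<close> yields \<open>dc = 0\<close>, hence
  \<open>c\<close> and \<open>W = k\<close> are constant, and \<open>(norm (y + c F x))\<^sup>2 = k F\<^sup>2\<close> is a quadratic equation for \<open>F\<close> whose
  positive root is the Funk-type metric. Conversely, differentiating this quadratic equation gives
  \<open>F\<^sub>x = c F F\<^sub>y\<close> back, whence \<open>G = (c / 2) F y\<close>, and \<open>H = - (c / 3) F\<^sup>3\<close> is a dual potential.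
\<close>

subsection \<open>Local existence for ordinary differential equations\<close>

text \<open>Geometrically, \<open>W = k\<close> says that the indicatrix \<open>F x y = 1\<close> at
  \<open>x\<close> is the Euclidean sphere of radius \<open>sqrt k\<close> centred at
  \<open>- c x\<close>; for k = c = 1 it is the unit sphere translated by \<open>- x\<close>, which
  is the Funk metric. The relation \<open>F\<^sub>x = c F F\<^sub>y\<close> and rotation invariance
  make the normal \<open>F\<^sub>y\<close> of the indicatrix point along the radius from
  \<open>- c x\<close>, and a connected hypersurface with that property lies on a sphere. Dimension
  at least 2 supplies this connectedness, and also the vectors orthogonal to \<open>x\<close>.
  Projective flatness speaks of geodesics only, so it says nothing about the spray at
  \<open>(x, y)\<close> until a geodesic with these initial data exists; hence the Picard theorem.
  It asks merely for a locally Lipschitz spray, which Cramer's rule supplies from the smooth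
  coefficients of the linear system for G. The comparison of directions orthogonal and parallel to
  \<open>x\<close> breaks down at the origin, so \<open>dc = 0\<close> is first obtained elsewhere
  and the origin is bridged by continuity of \<open>c\<close>.\<close>

lemma picard_global:
  fixes f :: "'a::euclidean_space \<Rightarrow> 'a"
  assumes f: "L-lipschitz_on UNIV f" and d: "0 < d" "4 * d * L < 1"
  obtains u where "u 0 = z0" "\<And>t. t \<in> {-d<..<d} \<Longrightarrow> (u has_vector_derivative f (u t)) (at t)"
    "continuous_on UNIV u"
proof -
  \<comment> \<open>Clamping time to [-d, d] lets the Picard operator act on bounded continuous
    functions on the whole line, a complete space to which Banach's theorem applies.\<close>
  define cl where "cl t = max (- d) (min d t)" for t :: real
  have cl: "cl t \<in> {-d..d}" for t using d by (auto simp: cl_def)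
  have cl_id: "cl t = t" if "t \<in> {-d..d}" for t using that by (auto simp: cl_def)
  have contf: "continuous_on UNIV f" using f by (rule lipschitz_on_continuous_on)
  have L: "0 \<le> L" using f by (rule lipschitz_on_nonneg)
  have contfu: "continuous_on {a..b} (\<lambda>s. f (apply_bcontfun v s))" for a b and v :: "real \<Rightarrow>\<^sub>C 'a"
    by (rule continuous_on_compose2[OF contf]) auto
  define I where "I v t = integral {-d..t} (\<lambda>s. f (apply_bcontfun v s))" for v :: "real \<Rightarrow>\<^sub>C 'a" and t
  have I_deriv: "(I v has_vector_derivative f (v t)) (at t within {-d..d})" if "t \<in> {-d..d}" for v t
    unfolding I_def using integral_has_vector_derivative[OF contfu that] by simp
  have contI: "continuous_on {-d..d} (I v)" for v
    unfolding continuous_on_eq_continuous_within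
    by (auto intro: has_vector_derivative_continuous I_deriv)
  have I_diff: "norm (I v t - I w t) \<le> 2 * d * L * dist v w" if "t \<in> {-d..d}" for v w t
  proof -
    have "I v t - I w t = integral {-d..t} (\<lambda>s. f (v s) - f (w s))"
      unfolding I_def by (intro Henstock_Kurzweil_Integration.integral_diff[symmetric] integrable_continuous_real contfu)
    also have "norm \<dots> \<le> (L * dist v w) * (t - (- d))"
    proof (rule integral_bound)
      show "continuous_on {-d..t} (\<lambda>s. f (v s) - f (w s))" by (intro continuous_on_diff contfu)
      show "\<And>s. s \<in> {- d..t} \<Longrightarrow> norm (f (v s) - f (w s)) \<le> L * dist v w"
        using lipschitz_onD[OF f] dist_bounded L
        by (metis UNIV_I dist_norm mult_left_mono order_trans)
    qed (use that in auto)
    also have "\<dots> \<le> (L * dist v w) * (2 * d)" using that L by (intro mult_left_mono) auto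
    finally show ?thesis by (simp add: algebra_simps)
  qed
  \<comment> \<open>The integral starts at -d, and the value at 0 is subtracted, so one formula
    serves both signs of t. Each of the two integrals contributes 2 d L to the contraction constant,
    whence 4 d L.\<close>
  define T where "T v = Bcontfun (\<lambda>t. z0 + (I v (cl t) - I v 0))" for v
  have T_mem: "(\<lambda>t. z0 + (I v (cl t) - I v 0)) \<in> bcontfun" for v
  proof -
    have cont: "continuous_on UNIV (\<lambda>t. I v (cl t))"
      by (rule continuous_on_compose2[OF contI]) (use cl in \<open>auto simp: cl_def intro!: continuous_intros\<close>)
    have "bounded (I v ` {-d..d})"
      by (intro compact_imp_bounded compact_continuous_image contI) auto
    then have "bounded (range (\<lambda>t. I v (cl t)))" by (rule bounded_subset) (use cl in auto)
    then obtain B where B: "\<And>t. norm (I v (cl t)) \<le> B" unfolding bounded_iff by auto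
    have "norm (z0 + (I v (cl t) - I v 0)) \<le> norm z0 + (B + norm (I v 0))" for t
      by (intro norm_triangle_le norm_triangle_le_diff add_mono B order_refl)
    then show ?thesis using cont unfolding bcontfun_def bounded_iff
      by (auto intro!: continuous_intros)
  qed
  have T_apply: "apply_bcontfun (T v) t = z0 + (I v (cl t) - I v 0)" for v t
    unfolding T_def using Bcontfun_inverse[OF T_mem] by simp
  have "\<exists>!v. T v = v"
  proof (rule banach_fix_type[of "4 * d * L"])
    show "\<forall>v w. dist (T v) (T w) \<le> 4 * d * L * dist v w"
    proof (intro allI dist_bound)
      fix v w t
      have "dist (T v t) (T w t) = norm ((I v (cl t) - I w (cl t)) - (I v 0 - I w 0))"
        unfolding T_apply dist_norm by (simp add: algebra_simps)
      also have "\<dots> \<le> 2 * d * L * dist v w + 2 * d * L * dist v w"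
        using d by (intro norm_triangle_le_diff add_mono I_diff cl) auto
      finally show "dist (T v t) (T w t) \<le> 4 * d * L * dist v w" by (simp add: ac_simps)
    qed
  qed (use d L in auto)
  then obtain v where v: "T v = v" by blast
  have u: "apply_bcontfun v t = z0 + (I v t - I v 0)" if "t \<in> {-d..d}" for t
    using T_apply[of v t] that by (simp add: v cl_id)
  show ?thesis
  proof (rule that[of "apply_bcontfun v"])
    show "v 0 = z0" using u[of 0] d by simp
    fix t assume t: "t \<in> {-d<..<d}"
    have "(I v has_vector_derivative f (v t)) (at t within {-d<..<d})"
      by (rule has_vector_derivative_within_subset[OF I_deriv]) (use t in auto)
    then have "((\<lambda>t. z0 + (I v t - I v 0)) has_vector_derivative f (v t)) (at t within {-d<..<d})"
      by (auto intro!: derivative_eq_intros)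
    then show "(v has_vector_derivative f (v t)) (at t)"
      using t u by (subst (asm) at_within_open[of t])
        (auto intro: has_vector_derivative_transform_within_open[of _ _ _ "{-d<..<d}"])
  qed auto
qed

text \<open>The nearest-point projection onto the ball is 1-Lipschitz, so composing with it extends
  \<open>f\<close> to a globally Lipschitz field. By continuity the solution of the extended
  equation stays in the ball for a short time, and there the projection is the identity.\<close>

lemma picard_local:
  fixes f :: "'a::euclidean_space \<Rightarrow> 'a"
  assumes f: "L-lipschitz_on (cball z0 e) f" and e: "0 < e"
  obtains d u where "0 < d" "u 0 = z0"
    "\<And>t. t \<in> {-d<..<d} \<Longrightarrow> u t \<in> ball z0 e"
    "\<And>t. t \<in> {-d<..<d} \<Longrightarrow> (u has_vector_derivative f (u t)) (at t)"
proof -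
  let ?p = "closest_point (cball z0 e)"
  have p: "?p z \<in> cball z0 e" for z by (rule closest_point_in_set) (use e in auto)
  have L: "0 \<le> L" using f by (rule lipschitz_on_nonneg)
  have "L-lipschitz_on UNIV (f \<circ> ?p)"
  proof (rule lipschitz_onI)
    fix a b
    have "dist (f (?p a)) (f (?p b)) \<le> L * dist (?p a) (?p b)" by (rule lipschitz_onD[OF f p p])
    also have "\<dots> \<le> L * dist a b"
      using e L by (intro mult_left_mono closest_point_lipschitz) auto
    finally show "dist ((f \<circ> ?p) a) ((f \<circ> ?p) b) \<le> L * dist a b" by simp
  qed (rule L)
  \<comment> \<open>This gives 4 d L = L / (L + 1) < 1, also when L = 0.\<close>
  moreover define d where "d = 1 / (4 * L + 4)"
  moreover have "0 < d" "4 * d * L < 1" using L by (auto simp: d_def field_simps)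
  ultimately obtain u where u: "u 0 = z0" "continuous_on UNIV u"
    "\<And>t. t \<in> {-d<..<d} \<Longrightarrow> (u has_vector_derivative (f \<circ> ?p) (u t)) (at t)"
    using picard_global by blast
  have "open (u -` ball z0 e)" using u(2) by (simp add: open_vimage)
  then obtain d' where d': "0 < d'" "ball 0 d' \<subseteq> u -` ball z0 e"
    using e u(1) by (metis centre_in_ball open_contains_ball vimageI)
  show ?thesis
  proof (rule that[of "min d d'" u])
    fix t assume t: "t \<in> {- min d d'<..<min d d'}"
    then show B: "u t \<in> ball z0 e" using d' by (auto simp: subset_iff dist_real_def)
    then have "?p (u t) = u t" by (intro closest_point_self) auto
    then show "(u has_vector_derivative f (u t)) (at t)" using u(3)[of t] t by fastforce
  qed (use \<open>0 < d\<close> d' u in auto)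
qed

text \<open>The regularity that the Picard theorem consumes. It is closed under sums, products and
  reciprocals with short direct proofs, which suffices for a spray obtained by inverting a
  matrix.\<close>

definition lipschitz_near :: "'a::metric_space \<Rightarrow> ('a \<Rightarrow> 'b::metric_space) \<Rightarrow> bool" where
  "lipschitz_near z f \<longleftrightarrow> (\<exists>e>0. \<exists>L. L-lipschitz_on (cball z e) f)"

lemma lipschitz_near_cong:
  assumes "lipschitz_near z f" "open S" "z \<in> S" "\<And>w. w \<in> S \<Longrightarrow> f w = g w"
  shows "lipschitz_near z g"
proof -
  obtain e L where e: "e > 0" "L-lipschitz_on (cball z e) f"
    using assms unfolding lipschitz_near_def by blast
  obtain e' where e': "e' > 0" "cball z e' \<subseteq> S" using assms open_contains_cball by blast
  have "L-lipschitz_on (cball z (min e e')) f"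
    by (rule lipschitz_on_subset[OF e(2)]) auto
  then have "L-lipschitz_on (cball z (min e e')) g"
    using e' assms(4) by (elim lipschitz_on_transform) (auto simp: subset_iff)
  then show ?thesis unfolding lipschitz_near_def using e e' by (intro exI[of _ "min e e'"]) auto
qed

lemma lipschitz_near_both:
  assumes "lipschitz_near z f" "lipschitz_near z g"
  obtains e L M where "e > 0" "L-lipschitz_on (cball z e) f" "M-lipschitz_on (cball z e) g"
proof -
  obtain e L where e: "e > 0" "L-lipschitz_on (cball z e) f"
    using assms unfolding lipschitz_near_def by blast
  obtain e' M where e': "e' > 0" "M-lipschitz_on (cball z e') g"
    using assms unfolding lipschitz_near_def by blast
  show ?thesis
    by (rule that[of "min e e'" L M]) (use e e' in \<open>auto elim: lipschitz_on_subset\<close>)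
qed

lemma lipschitz_near_const: "lipschitz_near z (\<lambda>w. c)"
  unfolding lipschitz_near_def
  by (rule exI[of _ 1]) (auto intro!: exI[of _ 0] lipschitz_onI)

lemma lipschitz_near_add:
  fixes f g :: "'a::metric_space \<Rightarrow> 'b::real_normed_vector"
  assumes "lipschitz_near z f" "lipschitz_near z g"
  shows "lipschitz_near z (\<lambda>w. f w + g w)"
  using lipschitz_near_both[OF assms] unfolding lipschitz_near_def by (metis lipschitz_on_add)

lemma lipschitz_on_cball_bounded:
  assumes "L-lipschitz_on (cball z e) f"
  shows "bounded (f ` cball z e)"
proof -
  have "dist (f z) (f w) \<le> L * e" if "w \<in> cball z e" for w
  proof -
    have "dist (f z) (f w) \<le> L * dist z w"
      using that order_trans[OF zero_le_dist, of z w e] by (intro lipschitz_onD[OF assms]) auto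
    also have "\<dots> \<le> L * e" using that lipschitz_on_nonneg[OF assms] by (intro mult_left_mono) auto
    finally show ?thesis .
  qed
  then show ?thesis unfolding bounded_def by blast
qed

lemma lipschitz_near_mult:
  fixes f g :: "'a::metric_space \<Rightarrow> real"
  assumes "lipschitz_near z f" "lipschitz_near z g"
  shows "lipschitz_near z (\<lambda>w. f w * g w)"
proof -
  obtain e L M where e: "e > 0" "L-lipschitz_on (cball z e) f" "M-lipschitz_on (cball z e) g"
    using lipschitz_near_both[OF assms] .
  obtain A B where A: "\<And>w. w \<in> cball z e \<Longrightarrow> \<bar>f w\<bar> \<le> A" and B: "\<And>w. w \<in> cball z e \<Longrightarrow> \<bar>g w\<bar> \<le> B"
    using lipschitz_on_cball_bounded[OF e(2)] lipschitz_on_cball_bounded[OF e(3)]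
    unfolding bounded_iff by (metis image_eqI real_norm_def)
  have z: "z \<in> cball z e" using e by simp
  have A0: "0 \<le> A" "0 \<le> B" using A[OF z] B[OF z] by linarith+
  have LM: "0 \<le> L" "0 \<le> M" using e lipschitz_on_nonneg by auto
  have "(A * M + L * B)-lipschitz_on (cball z e) (\<lambda>w. f w * g w)"
  proof (rule lipschitz_onI)
    fix a b assume ab: "a \<in> cball z e" "b \<in> cball z e"
    have "f a * g a - f b * g b = f a * (g a - g b) + (f a - f b) * g b" by (simp add: algebra_simps)
    then have "dist (f a * g a) (f b * g b) \<le> \<bar>f a\<bar> * \<bar>g a - g b\<bar> + \<bar>f a - f b\<bar> * \<bar>g b\<bar>"
      unfolding dist_real_def by (metis abs_mult abs_triangle_ineq)
    also have "\<dots> \<le> A * (M * dist a b) + (L * dist a b) * B"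
      using lipschitz_onD[OF e(2) ab] lipschitz_onD[OF e(3) ab] A[OF ab(1)] B[OF ab(2)] A0 LM
      by (intro add_mono mult_mono) (auto simp: dist_real_def)
    finally show "dist (f a * g a) (f b * g b) \<le> (A * M + L * B) * dist a b" by (simp add: algebra_simps)
  qed (use A0 LM in auto)
  then show ?thesis unfolding lipschitz_near_def using e by blast
qed

lemma lipschitz_near_sum:
  fixes f :: "'i \<Rightarrow> 'a::metric_space \<Rightarrow> 'b::real_normed_vector"
  assumes "\<And>i. i \<in> A \<Longrightarrow> lipschitz_near z (f i)"
  shows "lipschitz_near z (\<lambda>w. \<Sum>i\<in>A. f i w)"
  using assms by (induction A rule: infinite_finite_induct)
    (auto intro: lipschitz_near_const lipschitz_near_add)

lemma lipschitz_near_prod: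
  fixes f :: "'i \<Rightarrow> 'a::metric_space \<Rightarrow> real"
  assumes "\<And>i. i \<in> A \<Longrightarrow> lipschitz_near z (f i)"
  shows "lipschitz_near z (\<lambda>w. \<Prod>i\<in>A. f i w)"
  using assms by (induction A rule: infinite_finite_induct)
    (auto intro: lipschitz_near_const lipschitz_near_mult)

lemma lipschitz_near_inverse:
  fixes f :: "'a::metric_space \<Rightarrow> real"
  assumes "lipschitz_near z f" "f z \<noteq> 0"
  shows "lipschitz_near z (\<lambda>w. inverse (f w))"
proof -
  obtain e L where e: "e > 0" "L-lipschitz_on (cball z e) f"
    using assms unfolding lipschitz_near_def by blast
  have L: "0 \<le> L" using e lipschitz_on_nonneg by auto
  define m where "m = \<bar>f z\<bar> / 2"
  have m: "m > 0" using assms(2) by (simp add: m_def)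
  \<comment> \<open>On a ball of radius m / (L + 1) the function varies by at most m, half of its
    absolute value at the centre, so it stays at least m away from 0.\<close>
  define e' where "e' = min e (m / (L + 1))"
  have e': "e' > 0" using e m L by (simp add: e'_def)
  have lb: "m \<le> \<bar>f w\<bar>" if "w \<in> cball z e'" for w
  proof -
    have "dist (f z) (f w) \<le> L * dist z w"
      by (rule lipschitz_onD[OF e(2)]) (use that e in \<open>auto simp: e'_def\<close>)
    also have "\<dots> \<le> (L + 1) * (m / (L + 1))"
      using that L by (intro mult_mono) (auto simp: e'_def)
    finally have "dist (f z) (f w) \<le> m" using L by simp
    then show ?thesis unfolding m_def dist_real_def by linarith
  qed
  have "(L / m\<^sup>2)-lipschitz_on (cball z e') (\<lambda>w. inverse (f w))"
  proof (rule lipschitz_onI)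
    fix a b assume ab: "a \<in> cball z e'" "b \<in> cball z e'"
    have nz: "f a \<noteq> 0" "f b \<noteq> 0" using lb[OF ab(1)] lb[OF ab(2)] m by auto
    have "dist (inverse (f a)) (inverse (f b)) = \<bar>f a - f b\<bar> / (\<bar>f a\<bar> * \<bar>f b\<bar>)"
      using nz by (simp add: dist_real_def divide_simps abs_minus_commute flip: abs_mult)

    also have "\<dots> \<le> (L * dist a b) / (m * m)"
    proof (rule frac_le)
      show "\<bar>f a - f b\<bar> \<le> L * dist a b"
        using lipschitz_onD[OF e(2), of a b] ab by (auto simp: dist_real_def e'_def)
      show "m * m \<le> \<bar>f a\<bar> * \<bar>f b\<bar>" using lb[OF ab(1)] lb[OF ab(2)] m by (intro mult_mono) auto
    qed (use L m in auto)
    finally show "dist (inverse (f a)) (inverse (f b)) \<le> L / m\<^sup>2 * dist a b"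
      by (simp add: power2_eq_square)
  qed (use L in auto)
  then show ?thesis unfolding lipschitz_near_def using e' by blast
qed

lemma lipschitz_near_det:
  fixes A :: "'a::metric_space \<Rightarrow> real^'n^'n"
  assumes "\<And>i j. lipschitz_near z (\<lambda>w. A w $ i $ j)"
  shows "lipschitz_near z (\<lambda>w. det (A w))"
  unfolding det_def
  by (intro lipschitz_near_sum lipschitz_near_mult lipschitz_near_prod lipschitz_near_const assms)

text \<open>Cramer's rule writes each component of the solution as a quotient of determinants, which
  are polynomials in the entries of \<open>A\<close> and \<open>b\<close>.\<close>

lemma lipschitz_near_solution:
  fixes A :: "'a::metric_space \<Rightarrow> real^'n^'n" and b s :: "'a \<Rightarrow> real^'n"
  assumes "\<And>i j. lipschitz_near z (\<lambda>w. A w $ i $ j)" "\<And>i. lipschitz_near z (\<lambda>w. b w $ i)"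
    and S: "open S" "z \<in> S" "\<And>w. w \<in> S \<Longrightarrow> det (A w) \<noteq> 0"
    and s: "\<And>w. w \<in> S \<Longrightarrow> A w *v s w = b w"
  shows "lipschitz_near z (\<lambda>w. s w $ k)"
proof -
  let ?B = "\<lambda>w. (\<chi> i j. if j = k then b w $ i else A w $ i $ j) :: real^'n^'n"
  have "s w $ k = det (?B w) * inverse (det (A w))" if "w \<in> S" for w
    using s[OF that] cramer[OF S(3)[OF that]] by (simp add: divide_inverse)
  moreover have "lipschitz_near z (\<lambda>w. det (?B w) * inverse (det (A w)))"
  proof (intro lipschitz_near_mult lipschitz_near_inverse lipschitz_near_det)
    fix i j
    show "lipschitz_near z (\<lambda>w. ?B w $ i $ j)" using assms by (cases "j = k") auto
  qed (simp_all add: assms S)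
  ultimately show ?thesis
    using lipschitz_near_cong[OF _ S(1,2), of "\<lambda>w. det (?B w) * inverse (det (A w))" "\<lambda>w. s w $ k"] by simp
qed

lemma lipschitz_near_componentwise:
  fixes f :: "'a::metric_space \<Rightarrow> 'b::euclidean_space"
  assumes "\<And>b. b \<in> Basis \<Longrightarrow> lipschitz_near z (\<lambda>w. f w \<bullet> b)"
  shows "lipschitz_near z f"
proof -
  have "lipschitz_near z (\<lambda>w. (f w \<bullet> b) *\<^sub>R b)" if b: "b \<in> Basis" for b
  proof -
    obtain e L where e: "e > 0" "L-lipschitz_on (cball z e) (\<lambda>w. f w \<bullet> b)"
      using assms[OF b] unfolding lipschitz_near_def by auto
    have "L-lipschitz_on (cball z e) (\<lambda>w. (f w \<bullet> b) *\<^sub>R b)"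
      using lipschitz_onD[OF e(2)] lipschitz_on_nonneg[OF e(2)] b
      by (intro lipschitz_onI) (auto simp: dist_norm simp flip: scaleR_left_diff_distrib)
    then show ?thesis using e unfolding lipschitz_near_def by blast
  qed
  then have "lipschitz_near z (\<lambda>w. \<Sum>b\<in>Basis. (f w \<bullet> b) *\<^sub>R b)" by (rule lipschitz_near_sum)
  then show ?thesis by (simp add: euclidean_representation)
qed

subsection \<open>Calculus of smooth functions of position and direction\<close>

lemma frechet_derivative_cong_open:
  assumes "open S" "z \<in> S" "\<And>w. w \<in> S \<Longrightarrow> f w = g w"
  shows "frechet_derivative f (at z) = frechet_derivative g (at z)"
proof -
  have "(f has_derivative D) (at z) = (g has_derivative D) (at z)" for D
    using assms by (auto intro: has_derivative_transform_within_open[of _ _ _ _ S])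
  then show ?thesis by (simp add: frechet_derivative_def)
qed

lemma Ck_on_cong:
  assumes "open S" "\<And>w. w \<in> S \<Longrightarrow> f w = g w" "Ck_on k f S"
  shows "Ck_on k g S"
  using assms(2,3)
proof (induction k arbitrary: f g)
  case 0
  then show ?case by (auto cong: continuous_on_cong)
next
  case (Suc k)
  have eq: "frechet_derivative f (at z) = frechet_derivative g (at z)" if "z \<in> S" for z
    using frechet_derivative_cong_open[OF assms(1) that Suc.prems(1)] .
  have "g differentiable (at z)" if "z \<in> S" for z
  proof -
    have "(f has_derivative frechet_derivative f (at z)) (at z)"
      using Suc.prems that frechet_derivative_works[THEN iffD1] by auto
    then have "(g has_derivative frechet_derivative f (at z)) (at z)"
      by (rule has_derivative_transform_within_open[OF _ assms(1) that Suc.prems(1)])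
    then show ?thesis unfolding differentiable_def by blast
  qed
  moreover have "Ck_on k (\<lambda>z. frechet_derivative g (at z) v) S" for v
    by (rule Suc.IH[of "\<lambda>z. frechet_derivative f (at z) v"]) (use Suc.prems eq in auto)
  ultimately show ?case by simp
qed

lemma Ck_on_Suc_imp: "Ck_on (Suc k) f S \<Longrightarrow> Ck_on k f S"
proof (induction k arbitrary: f)
  case 0
  then have "continuous (at z) f" if "z \<in> S" for z using differentiable_imp_continuous_within that by auto
  then show ?case by (simp add: continuous_at_imp_continuous_on)
next
  case (Suc k)
  from Suc.prems have d: "\<forall>z\<in>S. f differentiable (at z)"
    and C: "\<And>v. Ck_on (Suc k) (\<lambda>z. frechet_derivative f (at z) v) S" by simp_all
  from d Suc.IH[OF C] show ?case by simp
qed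

lemma frechet_derivative_eqI: "(f has_derivative D) (at z) \<Longrightarrow> frechet_derivative f (at z) = D"
  by (metis frechet_derivative_at)

lemma Ck_on_const: "Ck_on k (\<lambda>z. c) S"
  by (induction k arbitrary: c) (auto simp: frechet_derivative_const)

lemma Ck_on_add:
  assumes S: "open S"
  shows "Ck_on k f S \<Longrightarrow> Ck_on k g S \<Longrightarrow> Ck_on k (\<lambda>z. f z + g z) S"
proof (induction k arbitrary: f g)
  case 0
  then show ?case by (auto intro: continuous_intros)
next
  case (Suc k)
  have "Ck_on k (\<lambda>z. frechet_derivative (\<lambda>z. f z + g z) (at z) v) S" for v
  proof (rule Ck_on_cong[OF S])
    show "Ck_on k (\<lambda>z. frechet_derivative f (at z) v + frechet_derivative g (at z) v) S"
      using Suc by auto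
    fix z assume z: "z \<in> S"
    have "((\<lambda>z. f z + g z) has_derivative
        (\<lambda>v. frechet_derivative f (at z) v + frechet_derivative g (at z) v)) (at z)"
      using Suc.prems z by (intro has_derivative_add frechet_derivative_works[THEN iffD1]) auto
    then show "frechet_derivative f (at z) v + frechet_derivative g (at z) v =
        frechet_derivative (\<lambda>z. f z + g z) (at z) v"
      by (simp add: frechet_derivative_eqI)
  qed
  then show ?case using Suc.prems by simp
qed

lemma Ck_on_mult:
  assumes S: "open S"
  shows "Ck_on k f S \<Longrightarrow> Ck_on k g S \<Longrightarrow> Ck_on k (\<lambda>z. f z * g z) S"
proof (induction k arbitrary: f g)
  case 0
  then show ?case by (auto intro: continuous_intros)
next
  case (Suc k)
  have "Ck_on k (\<lambda>z. frechet_derivative (\<lambda>z. f z * g z) (at z) v) S" for v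
  proof (rule Ck_on_cong[OF S])
    \<comment> \<open>The product rule brings back the undifferentiated factors, whose order has to
      be lowered from \<open>Suc k\<close> to \<open>k\<close> before the induction hypothesis
      applies.\<close>
    show "Ck_on k (\<lambda>z. f z * frechet_derivative g (at z) v + frechet_derivative f (at z) v * g z) S"
      using Suc.prems Ck_on_Suc_imp[OF Suc.prems(1)] Ck_on_Suc_imp[OF Suc.prems(2)]
      by (intro Ck_on_add[OF S] Suc.IH) auto
    fix z assume z: "z \<in> S"
    have "((\<lambda>z. f z * g z) has_derivative
        (\<lambda>v. f z * frechet_derivative g (at z) v + frechet_derivative f (at z) v * g z)) (at z)"
      using Suc.prems z by (intro has_derivative_mult frechet_derivative_works[THEN iffD1]) auto
    then show "f z * frechet_derivative g (at z) v + frechet_derivative f (at z) v * g z =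
        frechet_derivative (\<lambda>z. f z * g z) (at z) v"
      by (simp add: frechet_derivative_eqI)
  qed
  then show ?case using Suc.prems by simp
qed

lemma smooth_on_add: "open S \<Longrightarrow> smooth_on f S \<Longrightarrow> smooth_on g S \<Longrightarrow> smooth_on (\<lambda>z. f z + g z) S"
  and smooth_on_mult: "open S \<Longrightarrow> smooth_on f S \<Longrightarrow> smooth_on g S \<Longrightarrow> smooth_on (\<lambda>z. f z * g z) S"
  and smooth_on_const: "smooth_on (\<lambda>z. c) S"
  and smooth_on_cong: "open S \<Longrightarrow> (\<And>w. w \<in> S \<Longrightarrow> f w = g w) \<Longrightarrow> smooth_on f S \<Longrightarrow> smooth_on g S"
  unfolding smooth_on_def by (blast intro: Ck_on_add Ck_on_mult Ck_on_const Ck_on_cong)+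

lemma smooth_on_sum:
  assumes "open S" "\<And>i. i \<in> A \<Longrightarrow> smooth_on (f i) S"
  shows "smooth_on (\<lambda>z. \<Sum>i\<in>A. f i z) S"
  using assms(2) by (induction A rule: infinite_finite_induct)
    (auto intro: smooth_on_const smooth_on_add[OF assms(1)])

lemma smooth_on_has_derivative:
  "smooth_on f S \<Longrightarrow> z \<in> S \<Longrightarrow> (f has_derivative frechet_derivative f (at z)) (at z)"
  unfolding smooth_on_def by (metis Ck_on.simps(2) frechet_derivative_works)

lemma smooth_on_frechet_derivative:
  "smooth_on f S \<Longrightarrow> smooth_on (\<lambda>z. frechet_derivative f (at z) v) S"
  unfolding smooth_on_def by (metis Ck_on.simps(2))

lemma smooth_on_continuous_on: "smooth_on f S \<Longrightarrow> continuous_on S f"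
  unfolding smooth_on_def by (metis Ck_on.simps(1))

lemma smooth_on_bounded_linear:
  assumes l: "bounded_linear l"
  shows "smooth_on l S"
proof -
  have "Ck_on k l S" for k
  proof (cases k)
    case 0
    then show ?thesis using linear_continuous_on[OF l] by simp
  next
    case (Suc k')
    have "(l has_derivative l) (at z)" for z by (rule bounded_linear_imp_has_derivative[OF l])
    then show ?thesis using Suc
      by (auto simp: frechet_derivative_eqI[of l l] Ck_on_const differentiable_def)
  qed
  then show ?thesis by (simp add: smooth_on_def)
qed

text \<open>On a compact ball the continuous derivative is bounded in each basis direction. The sum
  of these bounds dominates its operator norm, and the mean value inequality on the convex ball
  finishes.\<close>

lemma smooth_on_imp_lipschitz_near:
  assumes f: "smooth_on f S" and S: "open S" "z \<in> S"
  shows "lipschitz_near z f"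
proof -
  obtain e where e: "e > 0" "cball z e \<subseteq> S" using S open_contains_cball by blast
  have "bounded ((\<lambda>w. frechet_derivative f (at w) b) ` cball z e)" for b
    by (intro compact_imp_bounded compact_continuous_image compact_cball
        continuous_on_subset[OF smooth_on_continuous_on[OF smooth_on_frechet_derivative[OF f]] e(2)])
  then have "\<exists>B. \<forall>w\<in>cball z e. \<bar>frechet_derivative f (at w) b\<bar> \<le> B" for b
    unfolding bounded_iff by auto
  then obtain B where B: "\<And>b w. w \<in> cball z e \<Longrightarrow> \<bar>frechet_derivative f (at w) b\<bar> \<le> B b" by metis
  define M where "M = (\<Sum>b\<in>Basis. B b)"
  have bound: "onorm (frechet_derivative f (at w)) \<le> M" if w: "w \<in> cball z e" for w
  proof (rule onorm_le)
    fix v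
    interpret bounded_linear "frechet_derivative f (at w)"
      using smooth_on_has_derivative[OF f] e w has_derivative_bounded_linear by blast
    have "frechet_derivative f (at w) v = (\<Sum>b\<in>Basis. (v \<bullet> b) * frechet_derivative f (at w) b)"
      by (subst euclidean_representation[of v, symmetric]) (simp add: sum scale)
    also have "norm \<dots> \<le> (\<Sum>b\<in>Basis. norm v * B b)"
      by (intro order_trans[OF norm_sum] sum_mono)
        (use B[OF w] in \<open>auto simp: abs_mult intro!: mult_mono Basis_le_norm\<close>)
    finally show "norm (frechet_derivative f (at w) v) \<le> M * norm v"
      by (simp add: M_def sum_distrib_left sum_distrib_right mult.commute)
  qed
  have "0 \<le> M"
    using B[of z] e by (auto simp: M_def intro!: sum_nonneg intro: order_trans[OF abs_ge_zero])
  have "M-lipschitz_on (cball z e) f"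
  proof (rule bounded_derivative_imp_lipschitz)
    show "(f has_derivative frechet_derivative f (at w)) (at w within cball z e)" if "w \<in> cball z e" for w
      using smooth_on_has_derivative[OF f] e that by (blast intro: has_derivative_at_withinI)
  qed (use bound \<open>0 \<le> M\<close> in auto)
  then show ?thesis using e unfolding lipschitz_near_def by blast
qed

lemma open_slit: "open \<Omega> \<Longrightarrow> open (slit \<Omega>)"
  unfolding slit_def by (intro open_Times open_Compl) auto

section \<open>Partial gradients, and homogeneity in the direction variable\<close>

definition grad_x :: "(real^'n::finite \<Rightarrow> real^'n \<Rightarrow> real) \<Rightarrow> real^'n \<Rightarrow> real^'n \<Rightarrow> real^'n" where
  "grad_x f x y = (\<chi> i. Dx i f x y)"

definition grad_y :: "(real^'n::finite \<Rightarrow> real^'n \<Rightarrow> real) \<Rightarrow> real^'n \<Rightarrow> real^'n \<Rightarrow> real^'n" where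
  "grad_y f x y = (\<chi> i. Dy i f x y)"

lemma grad_component: "grad_x f x y $ i = Dx i f x y" "grad_y f x y $ i = Dy i f x y"
  by (simp_all add: grad_x_def grad_y_def)

lemma deriv_along:
  fixes g :: "'a::real_normed_vector \<Rightarrow> real"
  assumes "(g has_derivative D) (at p)"
  shows "deriv (\<lambda>t. g (p + t *\<^sub>R v)) 0 = D v"
proof -
  have "((\<lambda>t. p + t *\<^sub>R v) has_derivative (\<lambda>t. t *\<^sub>R v)) (at 0)"
    by (auto intro!: derivative_eq_intros)
  then have "((\<lambda>t. g (p + t *\<^sub>R v)) has_derivative (\<lambda>t. D (t *\<^sub>R v))) (at 0)"
    using assms by (intro has_derivative_compose[where g=g and f="\<lambda>t. p + t *\<^sub>R v"]) auto
  moreover have "D (t *\<^sub>R v) = D v * t" for t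
    using has_derivative_bounded_linear[OF assms] linear_simps(5) by (metis mult.commute real_scaleR_def)
  ultimately show ?thesis
    by (intro DERIV_imp_deriv) (simp add: has_field_derivative_def)
qed

lemma vec_axis_expansion:
  fixes v :: "real^'n"
  shows "v = (\<Sum>i\<in>UNIV. v $ i *\<^sub>R axis i 1)"
  using basis_expansion[of v] by (simp add: scalar_mult_eq_scaleR)

lemma grad_x_unique:
  assumes "((\<lambda>x. f x y) has_derivative D) (at x)"
  shows "grad_x f x y \<bullet> v = D v"
proof -
  interpret bounded_linear D using assms by (rule has_derivative_bounded_linear)
  have "D v = (\<Sum>i\<in>UNIV. v $ i * D (axis i 1))"
    by (subst vec_axis_expansion[of v]) (simp add: sum scale)
  moreover have "Dx i f x y = D (axis i 1)" for i
    unfolding Dx_def by (rule deriv_along[OF assms])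
  ultimately show ?thesis by (simp add: inner_vec_def grad_component mult.commute)
qed

lemma grad_y_unique:
  assumes "(f x has_derivative D) (at y)"
  shows "grad_y f x y \<bullet> v = D v"
proof -
  interpret bounded_linear D using assms by (rule has_derivative_bounded_linear)
  have "D v = (\<Sum>i\<in>UNIV. v $ i * D (axis i 1))"
    by (subst vec_axis_expansion[of v]) (simp add: sum scale)
  moreover have "Dy i f x y = D (axis i 1)" for i
    unfolding Dy_def by (rule deriv_along[OF assms])
  ultimately show ?thesis by (simp add: inner_vec_def grad_component mult.commute)
qed

lemma grad_x_eqI: "((\<lambda>x. f x y) has_derivative (\<lambda>v. w \<bullet> v)) (at x) \<Longrightarrow> grad_x f x y = w"
  by (metis grad_x_unique vector_eq_rdot)

lemma grad_y_eqI: "(f x has_derivative (\<lambda>v. w \<bullet> v)) (at y) \<Longrightarrow> grad_y f x y = w"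
  by (metis grad_y_unique vector_eq_rdot)

lemma smooth_partial_derivatives:
  assumes "smooth_on (\<lambda>(x, y). f x y) S" "(x, y) \<in> S"
  shows "((\<lambda>x. f x y) has_derivative (\<lambda>v. frechet_derivative (\<lambda>(x, y). f x y) (at (x, y)) (v, 0))) (at x)"
    and "(f x has_derivative (\<lambda>v. frechet_derivative (\<lambda>(x, y). f x y) (at (x, y)) (0, v))) (at y)"
proof -
  let ?D = "frechet_derivative (\<lambda>(x, y). f x y) (at (x, y))"
  have D: "((\<lambda>(x, y). f x y) has_derivative ?D) (at (x, y))"
    by (rule smooth_on_has_derivative[OF assms])
  have X: "((\<lambda>x. (x, y)) has_derivative (\<lambda>v. (v, 0))) (at x)"
    and Y: "((\<lambda>y. (x, y)) has_derivative (\<lambda>v. (0, v))) (at y)"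
    by (intro has_derivative_Pair has_derivative_ident has_derivative_const)+
  show "((\<lambda>x. f x y) has_derivative (\<lambda>v. ?D (v, 0))) (at x)"
    using has_derivative_compose[where g="\<lambda>(x, y). f x y" and f="\<lambda>x. (x, y)" and x=x and f'="\<lambda>v. (v, 0)" and g'="?D" and s=UNIV] D
      X by simp
  show "(f x has_derivative (\<lambda>v. ?D (0, v))) (at y)"
    using has_derivative_compose[where g="\<lambda>(x, y). f x y" and f="\<lambda>y. (x, y)" and x=y and f'="\<lambda>v. (0, v)" and g'="?D" and s=UNIV] D
      Y by simp
qed

text \<open>The bridge from the coordinate derivatives \<open>Dx\<close>, \<open>Dy\<close> to
  Frechet derivatives: linearity splits the total derivative at \<open>(v, w)\<close> into its
  values at \<open>(v, 0)\<close> and \<open>(0, w)\<close>. From here on the calculus is free of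
  coordinates.\<close>

lemma smooth_has_derivative_grad:
  assumes "smooth_on (\<lambda>(x, y). f x y) S" "(x, y) \<in> S"
  shows "((\<lambda>(x, y). f x y) has_derivative (\<lambda>(v, w). grad_x f x y \<bullet> v + grad_y f x y \<bullet> w)) (at (x, y))"
    and "((\<lambda>x. f x y) has_derivative (\<lambda>v. grad_x f x y \<bullet> v)) (at x)"
    and "(f x has_derivative (\<lambda>v. grad_y f x y \<bullet> v)) (at y)"
proof -
  let ?D = "frechet_derivative (\<lambda>(x, y). f x y) (at (x, y))"
  have D: "((\<lambda>(x, y). f x y) has_derivative ?D) (at (x, y))"
    by (rule smooth_on_has_derivative[OF assms])
  note x = grad_x_unique[where f=f, OF smooth_partial_derivatives(1)[OF assms]]
  note y = grad_y_unique[where f=f, OF smooth_partial_derivatives(2)[OF assms]]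
  have "?D (v, w) = grad_x f x y \<bullet> v + grad_y f x y \<bullet> w" for v w
    unfolding x y using linear_simps(1)[OF has_derivative_bounded_linear[OF D], of "(v,0)" "(0,w)"] by simp
  then have "?D = (\<lambda>(v, w). grad_x f x y \<bullet> v + grad_y f x y \<bullet> w)" by auto
  with D show "((\<lambda>(x, y). f x y) has_derivative (\<lambda>(v, w). grad_x f x y \<bullet> v + grad_y f x y \<bullet> w)) (at (x, y))"
    by simp
  show "((\<lambda>x. f x y) has_derivative (\<lambda>v. grad_x f x y \<bullet> v)) (at x)"
    unfolding x by (rule smooth_partial_derivatives(1)[OF assms])
  show "(f x has_derivative (\<lambda>v. grad_y f x y \<bullet> v)) (at y)"
    unfolding y by (rule smooth_partial_derivatives(2)[OF assms])
qed

lemma smooth_on_Dx: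
  assumes "smooth_on (\<lambda>(x, y). f x y) S" "open S"
  shows "smooth_on (\<lambda>(x, y). Dx i f x y) S"
proof (rule smooth_on_cong[OF assms(2) _ smooth_on_frechet_derivative[OF assms(1)]])
  fix z assume "z \<in> S"
  moreover obtain x y where z: "z = (x, y)" by force
  ultimately show "frechet_derivative (\<lambda>(x, y). f x y) (at z) (axis i 1, 0) = (\<lambda>(x, y). Dx i f x y) z"
    using deriv_along[OF smooth_partial_derivatives(1)[OF assms(1)], of x y "axis i 1"]
    by (simp add: Dx_def)
qed

lemma smooth_on_Dy:
  assumes "smooth_on (\<lambda>(x, y). f x y) S" "open S"
  shows "smooth_on (\<lambda>(x, y). Dy i f x y) S"
proof (rule smooth_on_cong[OF assms(2) _ smooth_on_frechet_derivative[OF assms(1)]])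
  fix z assume "z \<in> S"
  moreover obtain x y where z: "z = (x, y)" by force
  ultimately show "frechet_derivative (\<lambda>(x, y). f x y) (at z) (0, axis i 1) = (\<lambda>(x, y). Dy i f x y) z"
    using deriv_along[OF smooth_partial_derivatives(2)[OF assms(1)], of x y "axis i 1"]
    by (simp add: Dy_def)
qed

text \<open>Euler's relation, from two computations of the derivative of \<open>f x (l y)\<close> in
  l at l = 1. The degree is real because that of the dual potential is not prescribed.\<close>

lemma euler_homogeneous:
  fixes f :: "real^'n \<Rightarrow> real^'n \<Rightarrow> real"
  assumes D: "(f x has_derivative (\<lambda>v. grad_y f x y \<bullet> v)) (at y)"
    and hom: "\<And>l. l > 0 \<Longrightarrow> f x (l *\<^sub>R y) = l powr d * f x y"
  shows "grad_y f x y \<bullet> y = d * f x y"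
proof -
  have "((\<lambda>l. f x (l *\<^sub>R y)) has_derivative (\<lambda>l. grad_y f x y \<bullet> (l *\<^sub>R y))) (at 1)"
    by (rule has_derivative_compose[where g="f x" and f="\<lambda>l. l *\<^sub>R y"])
      (use D in \<open>auto intro!: derivative_eq_intros\<close>)
  then have "((\<lambda>l. f x (l *\<^sub>R y)) has_real_derivative (grad_y f x y \<bullet> y)) (at 1)"
    by (simp add: has_field_derivative_def mult.commute[of _ "grad_y f x y \<bullet> y"] mult_commute_abs)
  then have 1: "((\<lambda>l. l powr d * f x y) has_real_derivative (grad_y f x y \<bullet> y)) (at 1)"
    by (rule has_field_derivative_transform_within_open[of _ _ _ "{0<..}"]) (auto simp: hom)
  have "((\<lambda>l. l powr d * f x y) has_real_derivative (d * f x y)) (at 1)"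
    by (auto intro!: derivative_eq_intros)
  with 1 show ?thesis by (rule DERIV_unique)
qed

text \<open>Away from 0, \<open>f x\<close> coincides with z \<mapsto>
  \<open>l powr d * f x (z / l)\<close>. Differentiating this at \<open>l y\<close> produces the
  factor 1 / l that lowers the degree by one.\<close>

lemma grad_y_homogeneous:
  fixes f :: "real^'n \<Rightarrow> real^'n \<Rightarrow> real"
  assumes D: "(f x has_derivative (\<lambda>v. grad_y f x y \<bullet> v)) (at y)" and "y \<noteq> 0" and l: "l > 0"
    and hom: "\<And>y. y \<noteq> 0 \<Longrightarrow> f x (l *\<^sub>R y) = l powr d * f x y"
  shows "grad_y f x (l *\<^sub>R y) = (l powr (d - 1)) *\<^sub>R grad_y f x y"
proof (rule grad_y_eqI)
  have "((\<lambda>z. f x (inverse l *\<^sub>R z)) has_derivative (\<lambda>v. grad_y f x y \<bullet> (inverse l *\<^sub>R v))) (at (l *\<^sub>R y))"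
    by (rule has_derivative_compose[where g="f x" and f="\<lambda>z. inverse l *\<^sub>R z"])
      (use D l in \<open>auto intro!: derivative_eq_intros\<close>)
  then have "((\<lambda>z. l powr d * f x (inverse l *\<^sub>R z)) has_derivative
      (\<lambda>v. l powr d * (grad_y f x y \<bullet> (inverse l *\<^sub>R v)))) (at (l *\<^sub>R y))"
    by (rule has_derivative_mult_right)
  then have "(f x has_derivative (\<lambda>v. l powr d * (grad_y f x y \<bullet> (inverse l *\<^sub>R v)))) (at (l *\<^sub>R y))"
  proof (rule has_derivative_transform_within_open[of _ _ _ _ "- {0}"])
    fix z :: "real^'n" assume "z \<in> - {0}"
    then show "l powr d * f x (inverse l *\<^sub>R z) = f x z"
      using hom[of "inverse l *\<^sub>R z"] l by simp
  qed (use \<open>y \<noteq> 0\<close> l in auto)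
  moreover have "l powr d * (grad_y f x y \<bullet> (inverse l *\<^sub>R v)) = ((l powr (d - 1)) *\<^sub>R grad_y f x y) \<bullet> v" for v
    using l by (simp add: powr_diff field_simps)
  ultimately show "(f x has_derivative (\<lambda>v. ((l powr (d - 1)) *\<^sub>R grad_y f x y) \<bullet> v)) (at (l *\<^sub>R y))"
    by (simp only:)
qed

lemma Dx_homogeneous:
  assumes "\<And>x. x \<in> \<Omega> \<Longrightarrow> f x (l *\<^sub>R y) = m * f x y" "open \<Omega>" "x \<in> \<Omega>"
    and D: "((\<lambda>x. f x y) has_derivative (\<lambda>v. grad_x f x y \<bullet> v)) (at x)"
  shows "Dx i f x (l *\<^sub>R y) = m * Dx i f x y"
proof -
  have "((\<lambda>x. m * f x y) has_derivative (\<lambda>v. m * (grad_x f x y \<bullet> v))) (at x)"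
    using D by (rule has_derivative_mult_right)
  then have "((\<lambda>x. f x (l *\<^sub>R y)) has_derivative (\<lambda>v. m * (grad_x f x y \<bullet> v))) (at x)"
    by (rule has_derivative_transform_within_open[OF _ assms(2,3)]) (simp add: assms(1))
  then have "((\<lambda>x. f x (l *\<^sub>R y)) has_derivative (\<lambda>v. (m *\<^sub>R grad_x f x y) \<bullet> v)) (at x)" by simp
  then have "grad_x f x (l *\<^sub>R y) = m *\<^sub>R grad_x f x y" by (rule grad_x_eqI)
  then show ?thesis by (metis grad_component(1) real_scaleR_def vector_scaleR_component)
qed

subsection \<open>Spray and geodesics of a Finsler metric\<close>

text \<open>Meant to be applied twice, to the curve and then to its velocity, so that a vector
  orthogonal to a line annihilates both velocity and acceleration of a curve in that line.\<close>

lemma orthogonal_to_curve_derivative: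
  fixes c c' :: "real \<Rightarrow> 'a::euclidean_space"
  assumes "\<And>t. t \<in> {-d<..<d} \<Longrightarrow> w \<bullet> c t = a"
    and c: "\<And>t. t \<in> {-d<..<d} \<Longrightarrow> (c has_vector_derivative c' t) (at t)"
  shows "t \<in> {-d<..<d} \<Longrightarrow> w \<bullet> c' t = 0"
proof -
  assume t: "t \<in> {-d<..<d}"
  have "((\<lambda>t. w \<bullet> c t) has_vector_derivative w \<bullet> c' t) (at t)"
    using c[OF t] by (rule bounded_linear.has_vector_derivative[OF bounded_linear_inner_right])
  then have "((\<lambda>t. a) has_vector_derivative w \<bullet> c' t) (at t)"
    by (rule has_vector_derivative_transform_within_open[of _ _ _ "{-d<..<d}"]) (use t assms in auto)
  then show ?thesis using vector_derivative_unique_at has_vector_derivative_const by blast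
qed

text \<open>If the acceleration is parallel to the velocity, the unit tangent \<open>T\<close> has
  derivative 0: the radial change of the velocity is cancelled by the change of its norm. The factor
  \<open>h\<close> is an arbitrary function.\<close>

lemma straight_geodesic:
  fixes c c' :: "real \<Rightarrow> 'a::euclidean_space"
  assumes c: "\<And>t. t \<in> {a<..<b} \<Longrightarrow> c' t \<noteq> 0 \<and> (c has_vector_derivative c' t) (at t) \<and>
      (c' has_vector_derivative h t *\<^sub>R c' t) (at t)" and ab: "a < b"
  shows "\<exists>p v. v \<noteq> 0 \<and> c ` {a<..<b} \<subseteq> range (\<lambda>s. p + s *\<^sub>R v)"
proof -
  define T where "T t = inverse (norm (c' t)) *\<^sub>R c' t" for t
  have "(T has_vector_derivative 0) (at t within {a<..<b})" if t: "t \<in> {a<..<b}" for t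
  proof -
    have nz: "c' t \<noteq> 0" and D: "(c' has_derivative (\<lambda>s. s *\<^sub>R h t *\<^sub>R c' t)) (at t)"
      using c[OF t] by (auto simp: has_vector_derivative_def)
    have N0: "((\<lambda>t. norm (c' t)) has_derivative (\<lambda>s. (s *\<^sub>R h t *\<^sub>R c' t) \<bullet> sgn (c' t))) (at t)"
      by (rule has_derivative_compose[OF D has_derivative_norm[OF nz]])
    have N1: "(s *\<^sub>R h t *\<^sub>R c' t) \<bullet> sgn (c' t) = s * (h t * norm (c' t))" for s
      using nz by (simp add: sgn_div_norm field_simps dot_square_norm power2_eq_square)
    have N: "((\<lambda>t. norm (c' t)) has_derivative (\<lambda>s. s * (h t * norm (c' t)))) (at t)"
      by (rule has_derivative_eq_rhs[OF N0 ext]) (rule N1)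
    have "(T has_derivative (\<lambda>s. inverse (norm (c' t)) *\<^sub>R (s *\<^sub>R h t *\<^sub>R c' t) +
       (- (inverse (norm (c' t)) * (s * (h t * norm (c' t))) * inverse (norm (c' t)))) *\<^sub>R c' t)) (at t)"
      unfolding T_def using nz by (intro has_derivative_scaleR[OF Deriv.has_derivative_inverse[OF _ N] D]) simp
    then have "(T has_derivative (\<lambda>s. 0)) (at t)"
      by (rule has_derivative_eq_rhs) (use nz in \<open>auto simp: fun_eq_iff field_simps\<close>)
    then show ?thesis by (simp add: has_vector_derivative_def has_derivative_at_withinI)
  qed
  then obtain v where v: "\<And>t. t \<in> {a<..<b} \<Longrightarrow> T t = v"
    using has_vector_derivative_zero_constant[of "{a<..<b}" T] by auto
  have c': "c' t = norm (c' t) *\<^sub>R v" if "t \<in> {a<..<b}" for t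
    using c[OF that] by (simp add: T_def flip: v[OF that])
  have v1: "norm v = 1" using c[of "(a+b)/2"] ab by (simp add: T_def flip: v[of "(a+b)/2"])
  \<comment> \<open>The component of the curve orthogonal to its constant direction \<open>v\<close>
    is constant; its value is the base point \<open>p\<close> of the line.\<close>
  have "((\<lambda>t. c t - (c t \<bullet> v) *\<^sub>R v) has_vector_derivative 0) (at t within {a<..<b})" if t: "t \<in> {a<..<b}" for t
  proof -
    have "bounded_linear (\<lambda>z. z - (z \<bullet> v) *\<^sub>R v)"
      by (intro bounded_linear_intros)
    from bounded_linear.has_vector_derivative[OF this, of c "c' t" "at t"] c[OF t]
    have "((\<lambda>t. c t - (c t \<bullet> v) *\<^sub>R v) has_vector_derivative c' t - (c' t \<bullet> v) *\<^sub>R v) (at t)" by simp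
    moreover have "c' t - (c' t \<bullet> v) *\<^sub>R v = 0"
      by (subst (1 2) c'[OF t]) (simp add: dot_square_norm v1)
    ultimately show ?thesis by (simp add: has_vector_derivative_at_within)
  qed
  then obtain p where p: "\<And>t. t \<in> {a<..<b} \<Longrightarrow> c t - (c t \<bullet> v) *\<^sub>R v = p"
    using has_vector_derivative_zero_constant[of "{a<..<b}" "\<lambda>t. c t - (c t \<bullet> v) *\<^sub>R v"] by auto
  have "c t \<in> range (\<lambda>s. p + s *\<^sub>R v)" if "t \<in> {a<..<b}" for t
    by (rule range_eqI[of _ _ "c t \<bullet> v"]) (simp flip: p[OF that])
  then show ?thesis using v1 by (intro exI[of _ p] exI[of _ v]) auto
qed

section \<open>The spray equation lowered by the fundamental tensor, and its solutions\<close>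

locale finsler_domain =
  fixes \<Omega> :: "(real^'n::finite) set" and F :: "real^'n \<Rightarrow> real^'n \<Rightarrow> real"
  assumes open_domain: "open \<Omega>" and finsler: "finsler_metric_on \<Omega> F"
begin

abbreviation L where "L \<equiv> sq F"

text \<open>\<open>L0\<close> is the derivative of \<open>L\<close> along the flat geodesic field.\<close>

definition L0 :: "real^'n \<Rightarrow> real^'n \<Rightarrow> real" where
  "L0 x y = (\<Sum>k\<in>UNIV. Dx k L x y * y $ k)"

lemma mem_slit: "(x, y) \<in> slit \<Omega> \<longleftrightarrow> x \<in> \<Omega> \<and> y \<noteq> 0"
  by (simp add: slit_def)

lemma open_slit_domain: "open (slit \<Omega>)"
  by (rule open_slit[OF open_domain])

lemma smooth_F: "smooth_on (\<lambda>(x, y). F x y) (slit \<Omega>)"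
  and F_pos: "x \<in> \<Omega> \<Longrightarrow> y \<noteq> 0 \<Longrightarrow> 0 < F x y"
  and F_hom: "x \<in> \<Omega> \<Longrightarrow> 0 < l \<Longrightarrow> F x (l *\<^sub>R y) = l * F x y"
  and tensor_pos: "x \<in> \<Omega> \<Longrightarrow> y \<noteq> 0 \<Longrightarrow> w \<noteq> 0 \<Longrightarrow> 0 < w \<bullet> (fundamental_tensor F x y *v w)"
  using finsler unfolding finsler_metric_on_def by blast+

lemma smooth_L: "smooth_on (\<lambda>(x, y). L x y) (slit \<Omega>)"
  using smooth_on_mult[OF open_slit_domain smooth_F smooth_F]
  by (simp add: sq_def power2_eq_square case_prod_unfold)

lemma smooth_DxL: "smooth_on (\<lambda>(x, y). Dx k L x y) (slit \<Omega>)"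
  and smooth_DyL: "smooth_on (\<lambda>(x, y). Dy k L x y) (slit \<Omega>)"
  by (intro smooth_on_Dx smooth_on_Dy smooth_L open_slit_domain)+

lemma smooth_L0: "smooth_on (\<lambda>(x, y). L0 x y) (slit \<Omega>)"
proof -
  have "bounded_linear (\<lambda>z :: (real^'n) \<times> (real^'n). snd z $ k)" for k
    by (rule bounded_linear_compose[OF bounded_linear_vec_nth bounded_linear_snd])
  then have "smooth_on (\<lambda>z. \<Sum>k\<in>UNIV. (\<lambda>(x, y). Dx k L x y) z * snd z $ k) (slit \<Omega>)"
    by (intro smooth_on_sum smooth_on_mult smooth_on_bounded_linear smooth_DxL open_slit_domain)
  then show ?thesis by (simp add: L0_def case_prod_unfold)
qed

context
  fixes x y :: "real^'n"
  assumes x: "x \<in> \<Omega>" and y: "y \<noteq> 0"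
begin

lemma in_slit: "(x, y) \<in> slit \<Omega>"
  using x y by (simp add: mem_slit)

lemmas F_has_derivative = smooth_has_derivative_grad[OF smooth_F in_slit]
lemmas L_has_derivative = smooth_has_derivative_grad[OF smooth_L in_slit]
lemmas L0_has_derivative = smooth_has_derivative_grad[OF smooth_L0 in_slit]
lemmas DxL_has_derivative = smooth_has_derivative_grad[OF smooth_DxL in_slit]
lemmas DyL_has_derivative = smooth_has_derivative_grad[OF smooth_DyL in_slit]

lemma L_hom: "l > 0 \<Longrightarrow> L x (l *\<^sub>R y) = l powr 2 * L x y"
  using x by (simp add: sq_def F_hom power_mult_distrib)

lemma L0_eq: "L0 x y = grad_x L x y \<bullet> y"
  by (simp add: L0_def inner_vec_def grad_component)

text \<open>Differentiating \<open>L0\<close> also hits the factor \<open>y\<close>, which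
  contributes \<open>grad_x L\<close>. Hence the bracket in the definition of the spray is
  \<open>grad_y L0 - 2 grad_x L\<close>, and the mixed second derivatives never have to be handled
  again.\<close>

lemma grad_y_L0: "grad_y L0 x y = (\<chi> l. \<Sum>k\<in>UNIV. Dy l (Dx k L) x y * y $ k) + grad_x L x y"
proof (rule grad_y_eqI)
  have "(L0 x has_derivative (\<lambda>v. \<Sum>k\<in>UNIV. Dx k L x y * v $ k + (grad_y (Dx k L) x y \<bullet> v) * y $ k)) (at y)"
    unfolding L0_def
    by (intro has_derivative_sum has_derivative_mult DxL_has_derivative
        bounded_linear_imp_has_derivative bounded_linear_vec_nth)
  moreover have "(\<Sum>k\<in>UNIV. Dx k L x y * v $ k + (grad_y (Dx k L) x y \<bullet> v) * y $ k) =
      ((\<chi> l. \<Sum>k\<in>UNIV. Dy l (Dx k L) x y * y $ k) + grad_x L x y) \<bullet> v" for v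
  proof -
    have "(\<Sum>k\<in>UNIV. (grad_y (Dx k L) x y \<bullet> v) * y $ k) =
        (\<Sum>k\<in>UNIV. \<Sum>l\<in>UNIV. Dy l (Dx k L) x y * v $ l * y $ k)"
      by (simp add: inner_vec_def grad_component sum_distrib_right)
    also have "\<dots> = (\<Sum>l\<in>UNIV. \<Sum>k\<in>UNIV. Dy l (Dx k L) x y * v $ l * y $ k)" by (rule sum.swap)
    also have "\<dots> = (\<chi> l. \<Sum>k\<in>UNIV. Dy l (Dx k L) x y * y $ k) \<bullet> v"
      by (simp add: inner_vec_def sum_distrib_left mult.commute mult.left_commute)
    finally show ?thesis
      by (simp add: sum.distrib inner_add_left inner_vec_def[of "grad_x L x y"] grad_component)
  qed
  ultimately show "(L0 x has_derivative
      (\<lambda>v. ((\<chi> l. \<Sum>k\<in>UNIV. Dy l (Dx k L) x y * y $ k) + grad_x L x y) \<bullet> v)) (at y)"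
    by (simp only:)
qed

lemma euler_F: "grad_y F x y \<bullet> y = F x y"
  using euler_homogeneous[OF F_has_derivative(3), of 1] F_hom[OF x] by simp

lemma euler_L: "grad_y L x y \<bullet> y = 2 * L x y"
  by (rule euler_homogeneous[OF L_has_derivative(3) L_hom])

lemma grad_L: "grad_x L x y = (2 * F x y) *\<^sub>R grad_x F x y" "grad_y L x y = (2 * F x y) *\<^sub>R grad_y F x y"
proof -
  have "((\<lambda>x. L x y) has_derivative (\<lambda>v. ((2 * F x y) *\<^sub>R grad_x F x y) \<bullet> v)) (at x)"
    unfolding sq_def power2_eq_square
    by (rule has_derivative_eq_rhs[OF has_derivative_mult[OF F_has_derivative(2) F_has_derivative(2)]])
      (auto simp: algebra_simps)
  then show "grad_x L x y = (2 * F x y) *\<^sub>R grad_x F x y" by (rule grad_x_eqI)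
  have "(L x has_derivative (\<lambda>v. ((2 * F x y) *\<^sub>R grad_y F x y) \<bullet> v)) (at y)"
    unfolding sq_def power2_eq_square
    by (rule has_derivative_eq_rhs[OF has_derivative_mult[OF F_has_derivative(3) F_has_derivative(3)]])
      (auto simp: algebra_simps)
  then show "grad_y L x y = (2 * F x y) *\<^sub>R grad_y F x y" by (rule grad_y_eqI)
qed

end

lemma L0_hom:
  assumes "x \<in> \<Omega>" "y \<noteq> 0" "l > 0"
  shows "L0 x (l *\<^sub>R y) = l powr 3 * L0 x y"
proof -
  have "Dx k L x (l *\<^sub>R y) = l powr 2 * Dx k L x y" for k
    by (rule Dx_homogeneous[where f=L and \<Omega>=\<Omega>, OF _ open_domain assms(1)])
      (use assms L_has_derivative(2)[OF assms(1,2)] L_hom in auto)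
  moreover have "l powr 3 = l powr 2 * l"
    using assms by (simp add: power_numeral_reduce)
  ultimately show ?thesis by (simp add: L0_def sum_distrib_left algebra_simps)
qed

lemma grad_y_L_hom:
  assumes "x \<in> \<Omega>" "y \<noteq> 0" "l > 0"
  shows "grad_y L x (l *\<^sub>R y) = l *\<^sub>R grad_y L x y"
    using grad_y_homogeneous[where f=L and d=2, OF L_has_derivative(3)[OF assms(1,2)] assms(2,3)]
    L_hom[OF assms(1) _ assms(3)] assms(3) by simp

lemma euler_L0:
  assumes "x \<in> \<Omega>" "y \<noteq> 0"
  shows "grad_y L0 x y \<bullet> y = 3 * L0 x y"
  by (rule euler_homogeneous[OF L0_has_derivative(3) L0_hom]) (use assms in auto)

text \<open>The components of \<open>grad_y L\<close> have degree 1, so Euler's relation evaluates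
  the second derivatives contracted with \<open>y\<close>. This is how a spray parallel to
  \<open>y\<close> becomes a statement about \<open>grad_y L\<close>.\<close>

lemma tensor_mult_self:
  assumes "x \<in> \<Omega>" "y \<noteq> 0"
  shows "fundamental_tensor F x y *v y = (1/2) *\<^sub>R grad_y L x y"
proof -
  have "Dy i L x (l *\<^sub>R y) = l powr 1 * Dy i L x y" if "l > 0" for i l
    using arg_cong[OF grad_y_L_hom[OF assms that], of "\<lambda>v. v $ i"] that by (simp add: grad_component)
  then have "grad_y (Dy i L) x y \<bullet> y = 1 * Dy i L x y" for i
    by (intro euler_homogeneous DyL_has_derivative assms)
  then have "(\<Sum>j\<in>UNIV. Dy j (Dy i L) x y * y $ j) = Dy i L x y" for i
    by (simp add: inner_vec_def grad_component)
  then show ?thesis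
    by (simp add: vec_eq_iff fundamental_tensor_def matrix_vector_mult_def grad_component
        flip: sum_divide_distrib)
qed

lemma tensor_inj:
  assumes "x \<in> \<Omega>" "y \<noteq> 0"
  shows "fundamental_tensor F x y *v v = fundamental_tensor F x y *v w \<Longrightarrow> v = w"
  using tensor_pos[OF assms, of "v - w"] by (auto simp: matrix_vector_mult_diff_distrib)

lemma tensor_invertible:
  assumes "x \<in> \<Omega>" "y \<noteq> 0"
  shows "invertible (fundamental_tensor F x y)"
  using tensor_inj[OF assms] by (auto simp: invertible_left_inverse matrix_left_invertible_injective inj_def)

lemma tensor_inv:
  assumes "x \<in> \<Omega>" "y \<noteq> 0"
  shows "fundamental_tensor F x y *v (inv_tensor F x y *v v) = v"
proof -
  have "fundamental_tensor F x y ** matrix_inv (fundamental_tensor F x y) = mat 1"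
    using tensor_invertible[OF assms] unfolding invertible_def matrix_inv_def by (rule someI2_ex) blast
  then show ?thesis by (simp add: inv_tensor_def matrix_vector_mul_assoc matrix_vector_mul_lid)
qed

text \<open>The spray with its index lowered. Later comparisons of vectors are carried out between
  covectors and transferred back by \<open>tensor_inj\<close>.\<close>

lemma tensor_spray:
  assumes "x \<in> \<Omega>" "y \<noteq> 0"
  shows "fundamental_tensor F x y *v spray F x y = (1/4) *\<^sub>R (grad_y L0 x y - 2 *\<^sub>R grad_x L x y)"
proof -
  have "spray F x y = inv_tensor F x y *v ((1/4) *\<^sub>R (grad_y L0 x y - 2 *\<^sub>R grad_x L x y))"
    unfolding grad_y_L0[OF assms]
    by (simp add: vec_eq_iff spray_def matrix_vector_mult_def grad_component sum_distrib_left mult.left_commute)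
  then show ?thesis by (simp only: tensor_inv[OF assms])
qed

lemma spray_lipschitz_near:
  assumes "x \<in> \<Omega>" "y \<noteq> 0"
  shows "lipschitz_near (x, y) (\<lambda>(x, y). spray F x y $ k)"
proof -
  note lip = smooth_on_imp_lipschitz_near[OF _ open_slit_domain in_slit[OF assms]]
  have "lipschitz_near (x, y) (\<lambda>w. (\<lambda>(x, y). spray F x y) w $ k)"
  proof (rule lipschitz_near_solution[OF _ _ open_slit_domain in_slit[OF assms]])
    fix i j
    have "smooth_on (\<lambda>z. (1/2) * (\<lambda>(x, y). Dy j (Dy i L) x y) z) (slit \<Omega>)"
      by (intro smooth_on_mult smooth_on_const smooth_on_Dy smooth_L open_slit_domain)
    from lip[OF this]
    show "lipschitz_near (x, y) (\<lambda>w. (\<lambda>(x, y). fundamental_tensor F x y) w $ i $ j)"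
      by (simp add: fundamental_tensor_def case_prod_unfold)
    have "smooth_on (\<lambda>z. (1/4) * ((\<lambda>(x, y). Dy i L0 x y) z + (-2) * (\<lambda>(x, y). Dx i L x y) z)) (slit \<Omega>)"
      by (intro smooth_on_mult smooth_on_add smooth_on_const smooth_on_Dy smooth_on_Dx smooth_L smooth_L0 open_slit_domain)
    from lip[OF this]
    show "lipschitz_near (x, y) (\<lambda>w. (\<lambda>(x, y). (1/4) *\<^sub>R (grad_y L0 x y - 2 *\<^sub>R grad_x L x y)) w $ i)"
      by (simp add: grad_component case_prod_unfold)
  qed (use tensor_spray tensor_invertible in \<open>auto simp: slit_def invertible_det_nz\<close>)
  then show ?thesis by (simp add: case_prod_unfold)
qed

text \<open>The second-order equation is solved as the first-order system for position and velocity
  on the open set \<open>slit \<Omega>\<close>. Shrinking the ball until it lies in the slit bundle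
  keeps the velocity nonzero.\<close>

lemma geodesic_exists:
  assumes x: "x \<in> \<Omega>" and y: "y \<noteq> 0"
  obtains d c c' where "0 < d" "c 0 = x" "c' 0 = y"
    "\<And>t. t \<in> {-d<..<d} \<Longrightarrow> c t \<in> \<Omega> \<and> c' t \<noteq> 0 \<and>
        (c has_vector_derivative c' t) (at t) \<and>
        (c' has_vector_derivative (- 2 *\<^sub>R spray F (c t) (c' t))) (at t)"
proof -
  define f where "f = (\<lambda>(x, y). (y, - 2 *\<^sub>R spray F x y))"
  have bl: "bounded_linear (\<lambda>z :: (real^'n) \<times> (real^'n). snd z \<bullet> b)" for b
    by (rule bounded_linear_compose[OF bounded_linear_inner_left bounded_linear_snd])
  have 1: "lipschitz_near (x, y) (\<lambda>z. snd z \<bullet> axis k 1)" for k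
    by (rule smooth_on_imp_lipschitz_near[OF smooth_on_bounded_linear[OF bl] open_slit_domain in_slit[OF x y]])
  have 2: "lipschitz_near (x, y) (\<lambda>z. - 2 * (\<lambda>(x, y). spray F x y $ k) z)" for k
    by (intro lipschitz_near_mult lipschitz_near_const spray_lipschitz_near x y)
  have "lipschitz_near (x, y) f"
  proof (rule lipschitz_near_componentwise)
    fix b :: "(real^'n) \<times> (real^'n)" assume "b \<in> Basis"
    then obtain k where "b = (axis k 1, 0) \<or> b = (0, axis k 1)"
      by (auto simp: Basis_prod_def Basis_vec_def)
    then show "lipschitz_near (x, y) (\<lambda>w. f w \<bullet> b)"
      using 1[of k] 2[of k] by (auto simp: f_def case_prod_unfold inner_axis)
  qed
  then obtain e M where e: "e > 0" and M: "M-lipschitz_on (cball (x, y) e) f"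
    unfolding lipschitz_near_def by blast
  obtain e' where e': "e' > 0" "ball (x, y) e' \<subseteq> slit \<Omega>"
    using open_slit_domain in_slit[OF x y] open_contains_ball by blast
  have "M-lipschitz_on (cball (x, y) (min e e')) f" by (rule lipschitz_on_subset[OF M]) auto
  then obtain d u where u: "0 < d" "u 0 = (x, y)"
    "\<And>t. t \<in> {-d<..<d} \<Longrightarrow> u t \<in> ball (x, y) (min e e')"
    "\<And>t. t \<in> {-d<..<d} \<Longrightarrow> (u has_vector_derivative f (u t)) (at t)"
    using picard_local[of M "(x, y)" "min e e'" f] e e' by (metis min_less_iff_conj)
  show ?thesis
  proof (rule that[of d "\<lambda>t. fst (u t)" "\<lambda>t. snd (u t)"])
    fix t assume t: "t \<in> {-d<..<d}"
    have "u t \<in> slit \<Omega>" using u(3)[OF t] e' by auto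
    moreover have "((\<lambda>t. fst (u t)) has_vector_derivative fst (f (u t))) (at t)"
      and "((\<lambda>t. snd (u t)) has_vector_derivative snd (f (u t))) (at t)"
      using u(4)[OF t]
      by (intro bounded_linear.has_vector_derivative[OF bounded_linear_fst]
          bounded_linear.has_vector_derivative[OF bounded_linear_snd]; simp)+
    ultimately show "fst (u t) \<in> \<Omega> \<and> snd (u t) \<noteq> 0 \<and>
        ((\<lambda>t. fst (u t)) has_vector_derivative snd (u t)) (at t) \<and>
        ((\<lambda>t. snd (u t)) has_vector_derivative (- 2 *\<^sub>R spray F (fst (u t)) (snd (u t)))) (at t)"
      by (auto simp: slit_def f_def case_prod_unfold)
  qed (use u in auto)
qed

text \<open>The geodesic with initial data \<open>(x, y)\<close> lies on a line with direction
  \<open>v\<close>. Every vector orthogonal to \<open>v\<close> kills its velocity \<open>y\<close>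
  and its acceleration \<open>- 2 G\<close> at time 0, so both are multiples of \<open>v\<close>,
  and \<open>y \<noteq> 0\<close> lets \<open>v\<close> be eliminated.\<close>

lemma projectively_flat_spray:
  assumes flat: "projectively_flat_on \<Omega> F" and x: "x \<in> \<Omega>" and y: "y \<noteq> 0"
  obtains P where "spray F x y = P *\<^sub>R y"
proof -
  obtain d c c' where d: "0 < d" "c 0 = x" "c' 0 = y"
    and c: "\<And>t. t \<in> {-d<..<d} \<Longrightarrow> c t \<in> \<Omega> \<and> c' t \<noteq> 0 \<and>
        (c has_vector_derivative c' t) (at t) \<and>
        (c' has_vector_derivative (- 2 *\<^sub>R spray F (c t) (c' t))) (at t)"
    using geodesic_exists[OF x y] by metis
  have "geodesic_on \<Omega> F (-d) d c" unfolding geodesic_on_def using c by blast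
  then obtain p v where v: "v \<noteq> 0" "c ` {-d<..<d} \<subseteq> range (\<lambda>s. p + s *\<^sub>R v)"
    using flat d unfolding projectively_flat_on_def by (metis neg_less_pos)
  have perp: "w \<bullet> y = 0 \<and> w \<bullet> spray F x y = 0" if w: "w \<bullet> v = 0" for w
  proof -
    have a: "w \<bullet> c t = w \<bullet> p" if "t \<in> {-d<..<d}" for t
    proof -
      obtain s where "c t = p + s *\<^sub>R v" using v(2) \<open>t \<in> _\<close> by blast
      then show ?thesis using w by (simp add: inner_add_right)
    qed
    have b: "w \<bullet> c' t = 0" if "t \<in> {-d<..<d}" for t
      by (rule orthogonal_to_curve_derivative[OF a _ that]) (use c in auto)
    have "w \<bullet> (- 2 *\<^sub>R spray F (c 0) (c' 0)) = 0"
      by (rule orthogonal_to_curve_derivative[OF b]) (use c d in auto)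
    then show ?thesis using b[of 0] d by simp
  qed
  have proj: "z = (z \<bullet> v / (v \<bullet> v)) *\<^sub>R v" if "\<And>w. w \<bullet> v = 0 \<Longrightarrow> w \<bullet> z = 0" for z
  proof -
    let ?w = "z - (z \<bullet> v / (v \<bullet> v)) *\<^sub>R v"
    have wv: "?w \<bullet> v = 0" using v by (simp add: inner_diff_left)
    have "?w \<bullet> ?w = ?w \<bullet> z - (z \<bullet> v / (v \<bullet> v)) * (?w \<bullet> v)" by (simp only: inner_diff_right inner_scaleR_right)
    also have "\<dots> = 0" using that[OF wv] wv by simp
    finally show ?thesis by simp
  qed
  obtain a where a: "y = a *\<^sub>R v" using proj[of y] perp by blast
  obtain b where b: "spray F x y = b *\<^sub>R v" using proj[of "spray F x y"] perp by blast
  have "spray F x y = (b / a) *\<^sub>R y" using a b y by auto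
  then show ?thesis by (rule that)
qed

end

subsection \<open>Flatness and spherical symmetry\<close>

context finsler_domain
begin

lemma grad_y_L0_hom:
  assumes "x \<in> \<Omega>" "y \<noteq> 0" "l > 0"
  shows "grad_y L0 x (l *\<^sub>R y) = l powr 2 *\<^sub>R grad_y L0 x y"
  using grad_y_homogeneous[where f=L0 and d=3, OF L0_has_derivative(3)[OF assms(1,2)] assms(2,3)]
    L0_hom[OF assms(1) _ assms(3)] by simp

lemma grad_x_L_hom:
  assumes "x \<in> \<Omega>" "y \<noteq> 0" "l > 0"
  shows "grad_x L x (l *\<^sub>R y) = l powr 2 *\<^sub>R grad_x L x y"
proof -
  have "Dx k L x (l *\<^sub>R y) = l powr 2 * Dx k L x y" for k
    by (rule Dx_homogeneous[where f=L and \<Omega>=\<Omega>, OF _ open_domain assms(1)])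
      (use assms L_has_derivative(2)[OF assms(1,2)] L_hom in auto)
  then show ?thesis by (simp add: vec_eq_iff grad_component)
qed

text \<open>The degree of \<open>H\<close> is not prescribed, but homogeneity forces it to be 3 unless \<open>H\<^sub>y = 0\<close>.\<close>

lemma dually_flat_grad:
  assumes flat: "locally_dually_flat_on \<Omega> F" and x: "x \<in> \<Omega>" and y: "y \<noteq> 0"
  shows "grad_y L0 x y = 3 *\<^sub>R grad_x L x y"
proof -
  obtain U H d where U: "open U" "x \<in> U" "U \<subseteq> \<Omega>"
    and H: "smooth_on (\<lambda>(x, y). H x y) (slit U)"
    and hom': "\<forall>x\<in>U. \<forall>y. y \<noteq> 0 \<longrightarrow> (\<forall>l>0. H x (l *\<^sub>R y) = l powr d * H x y)"
    and spr': "\<forall>x\<in>U. \<forall>y. y \<noteq> 0 \<longrightarrow> (\<forall>i. spray F x y $ i =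
              - (1/2) * (\<Sum>j\<in>UNIV. inv_tensor F x y $ i $ j * Dy j H x y))"
    using flat[unfolded locally_dually_flat_on_def, rule_format, OF x] by (elim exE conjE) (rule that)
  have hom: "H x (l *\<^sub>R z) = l powr d * H x z" if "z \<noteq> 0" "l > 0" for z l
    using hom' U(2) that by simp
  have spr: "spray F x z $ i = - (1/2) * (\<Sum>j\<in>UNIV. inv_tensor F x z $ i $ j * Dy j H x z)"
    if "z \<noteq> 0" for z i
    using spr' U(2) that by simp
  have DH: "(H x has_derivative (\<lambda>v. grad_y H x z \<bullet> v)) (at z)" if "z \<noteq> 0" for z
    by (rule smooth_has_derivative_grad(3)[OF H]) (use U that in \<open>auto simp: slit_def\<close>)
  have eq: "grad_y L0 x z - 2 *\<^sub>R grad_x L x z = - 2 *\<^sub>R grad_y H x z" if z: "z \<noteq> 0" for z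
  proof -
    have "spray F x z = inv_tensor F x z *v (- (1/2) *\<^sub>R grad_y H x z)"
      by (simp add: vec_eq_iff spr[OF z] matrix_vector_mult_def grad_component sum_distrib_left
          sum_negf mult.left_commute)
    then have "(1/4) *\<^sub>R (grad_y L0 x z - 2 *\<^sub>R grad_x L x z) = - (1/2) *\<^sub>R grad_y H x z"
      using tensor_spray[OF x z] tensor_inv[OF x z] by metis
    from arg_cong[OF this, of "\<lambda>v. 4 *\<^sub>R v"] show ?thesis by simp
  qed
  \<comment> \<open>Pairing the covector equation with \<open>y\<close> and using degree 3 on the
    left and degree \<open>d\<close> on the right determines \<open>H\<close> up to the factor
    \<open>d\<close>.\<close>
  have L0H: "L0 x z = - 2 * d * H x z" if z: "z \<noteq> 0" for z
  proof -
    have "grad_y H x z \<bullet> z = d * H x z"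
      by (rule euler_homogeneous[OF DH[OF z]]) (use hom z in auto)
    with arg_cong[OF eq[OF z], of "\<lambda>v. v \<bullet> z"] euler_L0[OF x z] L0_eq[OF x z, symmetric]
    show ?thesis by (simp add: inner_diff_left)
  qed
  have gradL0: "grad_y L0 x y = (- 2 * d) *\<^sub>R grad_y H x y"
  proof (rule grad_y_eqI)
    have "((\<lambda>z. - 2 * d * H x z) has_derivative (\<lambda>v. - 2 * d * (grad_y H x y \<bullet> v))) (at y)"
      by (intro has_derivative_mult_right DH y)
    then have "(L0 x has_derivative (\<lambda>v. - 2 * d * (grad_y H x y \<bullet> v))) (at y)"
      by (rule has_derivative_transform_within_open[of _ _ _ _ "- {0}"]) (use y L0H in auto)
    then show "(L0 x has_derivative (\<lambda>v. (- 2 * d) *\<^sub>R grad_y H x y \<bullet> v)) (at y)" by simp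
  qed
  show ?thesis
  proof (cases "d = 3")
    case True
    have "2 *\<^sub>R (grad_y L0 x y - 3 *\<^sub>R grad_x L x y) = 3 *\<^sub>R (grad_y L0 x y - 2 *\<^sub>R grad_x L x y) - grad_y L0 x y"
      by (simp add: algebra_simps vec_eq_iff)
    also have "\<dots> = 0" unfolding eq[OF y] using gradL0 True by simp
    finally show ?thesis by simp
  next
    case False
    \<comment> \<open>The left side of \<open>eq\<close> has degree 2 in the direction, while the
      gradient of \<open>H\<close> has degree d - 1. Comparing the values at \<open>y\<close> and
      \<open>2 y\<close> therefore forces the gradient to vanish unless d = 3.\<close>
    have y2: "2 *\<^sub>R y \<noteq> 0" using y by simp
    have "- 2 *\<^sub>R grad_y H x (2 *\<^sub>R y) = 4 *\<^sub>R (- 2 *\<^sub>R grad_y H x y)"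
      unfolding eq[OF y, symmetric] eq[OF y2, symmetric] grad_y_L0_hom[OF x y zero_less_numeral]
        grad_x_L_hom[OF x y zero_less_numeral] by (simp add: scaleR_diff_right)
    moreover have "grad_y H x (2 *\<^sub>R y) = (2 powr (d - 1)) *\<^sub>R grad_y H x y"
      by (rule grad_y_homogeneous[OF DH[OF y] y]) (use hom in auto)
    ultimately have "(2 powr (d - 1) - 4) *\<^sub>R grad_y H x y = 0"
      by (simp add: algebra_simps)
    moreover have "(2::real) powr (d - 1) \<noteq> 4"
    proof
      assume "(2::real) powr (d - 1) = 4"
      then have "(2::real) powr (d - 1) = 2 powr 2" by simp
      then have "d - 1 = 2" by (subst (asm) powr_inj) auto
      with False show False by simp
    qed
    ultimately have "grad_y H x y = 0" by simp
    then show ?thesis using gradL0 eq[OF y] by simp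
  qed
qed

text \<open>This is the only candidate for \<open>c\<close>: pairing
  \<open>F\<^sub>x = c F F\<^sub>y\<close> with \<open>y\<close> and using Euler's relation gives
  \<open>L0 = 2 c F ^ 3\<close>. As an explicit quotient it is visibly differentiable.\<close>

definition dual_factor :: "real^'n \<Rightarrow> real^'n \<Rightarrow> real" where
  "dual_factor x y = L0 x y / (2 * F x y ^ 3)"

text \<open>Dual flatness reduces the lowered spray to \<open>grad_x L / 4\<close>, and projective
  flatness makes it \<open>(P / 2) grad_y L\<close>. Pairing the resulting proportionality with
  \<open>y\<close> identifies \<open>2 P\<close> with
  \<open>dual_factor x y * F x y\<close>.\<close>

lemma flat_grad_x_F:
  assumes "projectively_flat_on \<Omega> F" "locally_dually_flat_on \<Omega> F" and x: "x \<in> \<Omega>" and y: "y \<noteq> 0"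
  shows "grad_x F x y = (dual_factor x y * F x y) *\<^sub>R grad_y F x y"
proof -
  note pos = F_pos[OF x y]
  obtain P where P: "spray F x y = P *\<^sub>R y" using projectively_flat_spray[OF assms(1) x y] .
  have "grad_y L0 x y - 2 *\<^sub>R grad_x L x y = grad_x L x y"
    unfolding dually_flat_grad[OF assms(2) x y] by (simp add: vec_eq_iff)
  then have "(1/4) *\<^sub>R grad_x L x y = (P/2) *\<^sub>R grad_y L x y"
    using tensor_spray[OF x y] tensor_mult_self[OF x y]
    by (simp add: P matrix_vector_mult_scaleR)
  from arg_cong[OF this, of "\<lambda>v. 4 *\<^sub>R v"]
  have 1: "grad_x L x y = (2 * P) *\<^sub>R grad_y L x y" by simp
  then have "L0 x y = (2 * P) * (2 * L x y)" using L0_eq[OF x y] euler_L[OF x y] by simp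
  then have P': "2 * P = dual_factor x y * F x y"
    using pos by (simp add: dual_factor_def sq_def field_simps power3_eq_cube power2_eq_square)
  have "(2 * F x y) *\<^sub>R grad_x F x y = (2 * F x y) *\<^sub>R ((dual_factor x y * F x y) *\<^sub>R grad_y F x y)"
    using 1 unfolding grad_L[OF x y] P' by (simp add: mult.commute)
  then show ?thesis using pos by (simp only: scaleR_cancel_left) simp
qed

text \<open>Both flatness conditions together give
  \<open>grad_y L0 = 6 c F\<^sup>2 F\<^sub>y\<close>, which is what differentiating
  \<open>2 c F ^ 3\<close> with \<open>c\<close> frozen would give. The quotient thus has derivative
  0 on the punctured fibre, which is connected in dimension at least 2.\<close>

lemma dual_factor_const:
  assumes "2 \<le> CARD('n)" "locally_dually_flat_on \<Omega> F" "projectively_flat_on \<Omega> F"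
    and x: "x \<in> \<Omega>" and y: "y \<noteq> 0" "y' \<noteq> 0"
  shows "dual_factor x y = dual_factor x y'"
proof (rule has_derivative_zero_unique_connected[where s="- {0}" and f="dual_factor x"])
  show "connected (- {0 :: real^'n})" by (rule connected_punctured_universe) (simp add: assms(1))
  fix y :: "real^'n" assume "y \<in> - {0}"
  then have y: "y \<noteq> 0" by simp
  note pos = F_pos[OF x y]
  have g: "grad_y L0 x y = (6 * dual_factor x y * (F x y)\<^sup>2) *\<^sub>R grad_y F x y"
    unfolding dually_flat_grad[OF assms(2) x y] grad_L[OF x y] flat_grad_x_F[OF assms(3,2) x y]
    by (simp add: power2_eq_square)
  have L0: "L0 x y = 2 * dual_factor x y * F x y ^ 3" using pos by (simp add: dual_factor_def)
  show "(dual_factor x has_derivative (\<lambda>v. 0)) (at y)"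
    unfolding dual_factor_def
  proof (rule has_derivative_eq_rhs[OF has_derivative_divide'[OF L0_has_derivative(3)[OF x y]
          has_derivative_mult_right[OF has_derivative_power[OF F_has_derivative(3)[OF x y]]]] ext])
    show "2 * F x y ^ 3 \<noteq> 0" using pos by simp
    show "((grad_y L0 x y \<bullet> v) * (2 * F x y ^ 3) -
        L0 x y * (2 * (of_nat 3 * (grad_y F x y \<bullet> v) * F x y ^ (3 - 1)))) / (2 * F x y ^ 3 * (2 * F x y ^ 3)) = 0" for v
      unfolding g L0 by (simp add: power2_eq_square power3_eq_cube)
  qed
qed (use y in auto)

lemma dual_factor_differentiable_x:
  assumes "x \<in> \<Omega>" "y \<noteq> 0"
  obtains D where "((\<lambda>x. dual_factor x y) has_derivative D) (at x)"
proof -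
  have "(\<lambda>x. L0 x y) differentiable (at x)" "(\<lambda>x. F x y) differentiable (at x)"
    using L0_has_derivative(2)[OF assms] F_has_derivative(2)[OF assms] by (auto simp: differentiable_def)
  then have "(\<lambda>x. dual_factor x y) differentiable (at x)"
    unfolding dual_factor_def using F_pos[OF assms] by (intro derivative_intros) auto
  then show ?thesis using that by (auto simp: differentiable_def)
qed

end

section \<open>Infinitesimal rotation invariance\<close>

definition plane_rotation :: "'n \<Rightarrow> 'n \<Rightarrow> real \<Rightarrow> real^'n \<Rightarrow> real^'n::finite" where
  "plane_rotation i j t z = z + (cos t - 1) *\<^sub>R (z $ i *\<^sub>R axis i 1 + z $ j *\<^sub>R axis j 1)
     + sin t *\<^sub>R (z $ i *\<^sub>R axis j 1 - z $ j *\<^sub>R axis i 1)"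

lemma plane_rotation_inner:
  assumes "i \<noteq> j"
  shows "plane_rotation i j t z \<bullet> plane_rotation i j t w = z \<bullet> w"
proof -
  let ?m = "z $ i * w $ i + z $ j * w $ j"
  have ax: "axis i 1 \<bullet> axis j (1::real) = 0" "axis j 1 \<bullet> axis i (1::real) = 0"
    "axis i 1 \<bullet> axis i (1::real) = 1" "axis j 1 \<bullet> axis j (1::real) = 1"
    using assms by (simp_all add: inner_axis_axis)
  have ax': "axis i (1::real) $ j = 0" "axis j (1::real) $ i = 0" using assms by (simp_all add: axis_def)
  define C S where "C = cos t - 1" and "S = sin t"
  \<comment> \<open>The terms linear in \<open>S\<close> cancel by antisymmetry; the remaining
    coefficient is \<open>(C + 1)\<^sup>2 + S\<^sup>2 - 1\<close>, that is, cos squared plus sin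
    squared minus 1.\<close>
  have "plane_rotation i j t z \<bullet> plane_rotation i j t w = z \<bullet> w + (2 * C + C\<^sup>2 + S\<^sup>2) * ?m"
    unfolding plane_rotation_def C_def[symmetric] S_def[symmetric]
    by (simp add: inner_add_left inner_add_right inner_diff_left inner_diff_right inner_axis inner_axis' ax ax'
        algebra_simps power2_eq_square)
  also have "2 * C + C\<^sup>2 + S\<^sup>2 = 0"
    using sin_cos_squared_add[of t] by (simp add: C_def S_def power2_eq_square algebra_simps)
  finally show ?thesis by simp
qed

lemma plane_rotation_norm: "i \<noteq> j \<Longrightarrow> norm (plane_rotation i j t z) = norm z"
  by (simp add: norm_eq_sqrt_inner plane_rotation_inner)

lemma plane_rotation_deriv:
  "((\<lambda>t. plane_rotation i j t z) has_derivative
     (\<lambda>s. s *\<^sub>R (z $ i *\<^sub>R axis j 1 - z $ j *\<^sub>R axis i 1))) (at 0)"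
  unfolding plane_rotation_def by (auto intro!: derivative_eq_intros)

locale spherical_finsler_domain = finsler_domain \<Omega> F
  for \<Omega> :: "(real^'n::finite) set" and F +
  fixes \<phi> :: "real \<Rightarrow> real \<Rightarrow> real \<Rightarrow> real"
  assumes F_phi: "\<And>x y. x \<in> \<Omega> \<Longrightarrow> y \<noteq> 0 \<Longrightarrow> F x y = \<phi> (norm x) (norm y) (x \<bullet> y)"
    and convex_domain: "convex \<Omega>" and dim: "2 \<le> CARD('n)"
begin

text \<open>Rotating point and direction together in the (i, j) plane fixes all three arguments of
  \<open>\<phi>\<close>; this is the derivative at t = 0. The domain may fail to be rotation
  invariant, but being open it contains the rotated point for small t.\<close>

lemma rotation_invariance:
  assumes x: "x \<in> \<Omega>" and y: "y \<noteq> 0" and ij: "i \<noteq> j"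
  shows "x $ i * Dx j F x y - x $ j * Dx i F x y + (y $ i * Dy j F x y - y $ j * Dy i F x y) = 0"
proof -
  let ?X = "\<lambda>t. plane_rotation i j t x" and ?Y = "\<lambda>t. plane_rotation i j t y"
  let ?A = "\<lambda>z. z $ i *\<^sub>R axis j 1 - z $ j *\<^sub>R axis i 1 :: real^'n"
  have X0: "?X 0 = x" "?Y 0 = y" by (simp_all add: plane_rotation_def)
  have "((\<lambda>t. (?X t, ?Y t)) has_derivative (\<lambda>s. (s *\<^sub>R ?A x, s *\<^sub>R ?A y))) (at 0)"
    by (intro has_derivative_Pair plane_rotation_deriv)
  from has_derivative_compose[OF this, of "\<lambda>(x, y). F x y"
      "\<lambda>(v, w). grad_x F x y \<bullet> v + grad_y F x y \<bullet> w"] F_has_derivative(1)[OF x y]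
  have D: "((\<lambda>t. F (?X t) (?Y t)) has_derivative
      (\<lambda>s. grad_x F x y \<bullet> (s *\<^sub>R ?A x) + grad_y F x y \<bullet> (s *\<^sub>R ?A y))) (at 0)"
    by (simp add: X0)
  have "continuous_on UNIV ?X" unfolding plane_rotation_def by (intro continuous_intros)
  then have "open (?X -` \<Omega>)" using open_domain by (simp add: open_vimage)
  then have "((\<lambda>t. F x y) has_derivative
      (\<lambda>s. grad_x F x y \<bullet> (s *\<^sub>R ?A x) + grad_y F x y \<bullet> (s *\<^sub>R ?A y))) (at 0)"
  proof (rule has_derivative_transform_within_open[OF D])
    fix t assume "t \<in> ?X -` \<Omega>"
    moreover have "?Y t \<noteq> 0" using plane_rotation_norm[OF ij, of t y] y by auto
    ultimately show "F (?X t) (?Y t) = F x y"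
      using F_phi x y by (simp add: plane_rotation_norm plane_rotation_inner ij)
  qed (use x X0 in auto)
  then have "(\<lambda>s. grad_x F x y \<bullet> (s *\<^sub>R ?A x) + grad_y F x y \<bullet> (s *\<^sub>R ?A y)) = (\<lambda>s. 0)"
    using has_derivative_unique has_derivative_const by blast
  from fun_cong[OF this, of 1] show ?thesis
    by (simp add: inner_diff_right inner_axis grad_component)
qed

lemma orthogonal_vector:
  obtains y :: "real^'n" where "y \<noteq> 0" "x \<bullet> y = 0"
  using orthogonal_to_vector_exists[of x] dim by (auto simp: orthogonal_def)

text \<open>\<open>W\<close> is a first integral: along the flow of \<open>F\<^sub>x = c F F\<^sub>y\<close> the value \<open>F\<close> and \<open>y + c F x\<close> are
  transported together, and by rotation invariance \<open>F\<close> is a multiple of \<open>\<bar>y + c F x\<bar>\<close>.\<close>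

definition W :: "real^'n \<Rightarrow> real^'n \<Rightarrow> real" where
  "W x y = (inverse (F x y) *\<^sub>R y + dual_factor x y *\<^sub>R x) \<bullet> (inverse (F x y) *\<^sub>R y + dual_factor x y *\<^sub>R x)"

section \<open>Rigidity: from flatness to the Funk-type formula\<close>

context
  assumes pflat: "projectively_flat_on \<Omega> F" and dflat: "locally_dually_flat_on \<Omega> F"
begin

text \<open>Inserting \<open>F\<^sub>x = c F F\<^sub>y\<close> into the rotation identity turns it
  into the vanishing of all 2 by 2 minors of \<open>z\<close> and \<open>grad_y F\<close>.
  Contracting them with \<open>w\<close> and \<open>y\<close> and applying Euler's relation
  expresses collinearity without a choice of proportionality factor.\<close>

lemma grad_y_collinear:
  assumes x: "x \<in> \<Omega>" and y: "y \<noteq> 0"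
  defines "z \<equiv> y + (dual_factor x y * F x y) *\<^sub>R x"
  shows "F x y * (z \<bullet> w) = (z \<bullet> y) * (grad_y F x y \<bullet> w)"
proof -
  let ?q = "dual_factor x y * F x y" and ?g = "grad_y F x y"
  have Dx: "Dx k F x y = ?q * ?g $ k" for k
    using arg_cong[OF flat_grad_x_F[OF pflat dflat x y], of "\<lambda>v. v $ k"] by (simp add: grad_component)
  have sym: "z $ i * ?g $ j = z $ j * ?g $ i" for i j
  proof (cases "i = j")
    case False
    show ?thesis
      using rotation_invariance[OF x y False] unfolding Dx grad_component(2)[symmetric]
      by (simp add: z_def algebra_simps)
  qed simp
  have "F x y * (z \<bullet> w) = (z \<bullet> w) * (?g \<bullet> y)" by (simp add: euler_F[OF x y])
  also have "\<dots> = (\<Sum>i\<in>UNIV. \<Sum>j\<in>UNIV. (z $ i * ?g $ j) * (w $ i * y $ j))"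
    by (simp add: inner_vec_def sum_product algebra_simps)
  also have "\<dots> = (\<Sum>i\<in>UNIV. \<Sum>j\<in>UNIV. (z $ j * ?g $ i) * (w $ i * y $ j))" by (simp only: sym)
  also have "\<dots> = (\<Sum>j\<in>UNIV. \<Sum>i\<in>UNIV. (z $ j * ?g $ i) * (w $ i * y $ j))" by (rule sum.swap)
  also have "\<dots> = (z \<bullet> y) * (?g \<bullet> w)"
    by (simp add: inner_vec_def sum_product algebra_simps)
  finally show ?thesis .
qed

text \<open>The second factor is the derivative of y \<mapsto> \<open>y / F x y\<close> in direction
  \<open>v\<close>, hence tangent to the indicatrix; the first is the radius vector from
  \<open>- c x\<close>. Both derivatives of \<open>W\<close> reduce to this orthogonality.\<close>

lemma W_grad_identity:
  assumes x: "x \<in> \<Omega>" and y: "y \<noteq> 0"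
  shows "(inverse (F x y) *\<^sub>R y + dual_factor x y *\<^sub>R x) \<bullet>
      (inverse (F x y) *\<^sub>R v + (- (inverse (F x y) * (grad_y F x y \<bullet> v) * inverse (F x y))) *\<^sub>R y) = 0"
proof -
  note pos = F_pos[OF x y]
  let ?z = "y + (dual_factor x y * F x y) *\<^sub>R x"
  have w: "inverse (F x y) *\<^sub>R y + dual_factor x y *\<^sub>R x = inverse (F x y) *\<^sub>R ?z"
    using pos by (simp add: scaleR_add_right)
  have "inverse (F x y) *\<^sub>R v + (- (inverse (F x y) * (grad_y F x y \<bullet> v) * inverse (F x y))) *\<^sub>R y
    = (inverse (F x y))\<^sup>2 *\<^sub>R (F x y *\<^sub>R v - (grad_y F x y \<bullet> v) *\<^sub>R y)"
    using pos by (simp add: vec_eq_iff power2_eq_square field_simps)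
  moreover have "?z \<bullet> (F x y *\<^sub>R v - (grad_y F x y \<bullet> v) *\<^sub>R y) = 0"
    using grad_y_collinear[OF x y, of v] by (simp add: inner_diff_right mult.commute)
  ultimately show ?thesis unfolding w by simp
qed

lemma W_const_y:
  assumes x: "x \<in> \<Omega>" and y: "y \<noteq> 0" "y' \<noteq> 0"
  shows "W x y = W x y'"
proof (rule has_derivative_zero_unique_connected[where s="- {0}" and f="W x"])
  show "connected (- {0 :: real^'n})" by (rule connected_punctured_universe) (simp add: dim)
  fix y :: "real^'n" assume "y \<in> - {0}"
  then have y: "y \<noteq> 0" by simp
  note pos = F_pos[OF x y]
  let ?c = "dual_factor x y"
  have "((\<lambda>y. inverse (F x y)) has_derivative (\<lambda>v. - (inverse (F x y) * (grad_y F x y \<bullet> v) * inverse (F x y)))) (at y)"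
    by (rule Deriv.has_derivative_inverse[OF _ F_has_derivative(3)[OF x y]]) (use pos in simp)
  then have "((\<lambda>y. inverse (F x y) *\<^sub>R y + ?c *\<^sub>R x) has_derivative
      (\<lambda>v. (inverse (F x y) *\<^sub>R v + (- (inverse (F x y) * (grad_y F x y \<bullet> v) * inverse (F x y))) *\<^sub>R y) + 0)) (at y)"
    by (intro has_derivative_add has_derivative_const has_derivative_scaleR[OF _ has_derivative_ident])
  from has_derivative_inner[OF this this]
  have "((\<lambda>y. (inverse (F x y) *\<^sub>R y + ?c *\<^sub>R x) \<bullet> (inverse (F x y) *\<^sub>R y + ?c *\<^sub>R x)) has_derivative (\<lambda>v. 0)) (at y)"
    by (rule has_derivative_eq_rhs)
      (use W_grad_identity[OF x y] in \<open>simp add: fun_eq_iff inner_commute\<close>)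
  then show "(W x has_derivative (\<lambda>v. 0)) (at y)"
  proof (rule has_derivative_transform_within_open[of _ _ _ _ "- {0}"])
    fix z :: "real^'n" assume "z \<in> - {0}"
    then have "dual_factor x z = ?c" by (intro dual_factor_const[OF dim dflat pflat x _ y]) simp
    then show "(inverse (F x z) *\<^sub>R z + ?c *\<^sub>R x) \<bullet> (inverse (F x z) *\<^sub>R z + ?c *\<^sub>R x) = W x z"
      by (simp add: W_def)
  qed (use y in auto)
qed (use y in auto)

text \<open>Because \<open>F\<^sub>x = c F F\<^sub>y\<close>, moving the point by \<open>v\<close>
  changes \<open>y / F + c x\<close> by \<open>c F\<close> times the tangent vector of
  \<open>W_grad_identity\<close>, plus \<open>D v\<close> times \<open>x\<close>. Only the second
  part survives the inner product.\<close>

lemma W_has_derivative_x: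
  assumes x: "x \<in> \<Omega>" and y: "y \<noteq> 0"
    and D: "((\<lambda>x. dual_factor x y) has_derivative D) (at x)"
  shows "((\<lambda>x. W x y) has_derivative
    (\<lambda>v. 2 * D v * ((inverse (F x y) *\<^sub>R y + dual_factor x y *\<^sub>R x) \<bullet> x))) (at x)"
proof -
  note pos = F_pos[OF x y]
  let ?c = "dual_factor x y"
  let ?w = "inverse (F x y) *\<^sub>R y + ?c *\<^sub>R x"
  let ?e = "\<lambda>v. inverse (F x y) *\<^sub>R v + (- (inverse (F x y) * (grad_y F x y \<bullet> v) * inverse (F x y))) *\<^sub>R y"
  let ?d = "\<lambda>v. inverse (F x y) *\<^sub>R 0 + (- (inverse (F x y) * (grad_x F x y \<bullet> v) * inverse (F x y))) *\<^sub>R y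
      + (?c *\<^sub>R v + D v *\<^sub>R x)"
  have "((\<lambda>x. inverse (F x y)) has_derivative (\<lambda>v. - (inverse (F x y) * (grad_x F x y \<bullet> v) * inverse (F x y)))) (at x)"
    by (rule Deriv.has_derivative_inverse[OF _ F_has_derivative(2)[OF x y]]) (use pos in simp)
  then have "((\<lambda>x. inverse (F x y) *\<^sub>R y + dual_factor x y *\<^sub>R x) has_derivative ?d) (at x)"
    by (intro has_derivative_add has_derivative_scaleR[OF _ has_derivative_const]
        has_derivative_scaleR[OF D has_derivative_ident])
  from has_derivative_inner[OF this this]
  have W': "((\<lambda>x. W x y) has_derivative (\<lambda>v. ?w \<bullet> ?d v + ?d v \<bullet> ?w)) (at x)"
    by (simp only: W_def)
  have "?d v = (?c * F x y) *\<^sub>R ?e v + D v *\<^sub>R x" for v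
    using pos by (simp add: flat_grad_x_F[OF pflat dflat x y] vec_eq_iff field_simps)
  then have "?w \<bullet> ?d v = (?c * F x y) * (?w \<bullet> ?e v) + D v * (?w \<bullet> x)" for v
    by (simp only: inner_add_right inner_scaleR_right)
  then have "?w \<bullet> ?d v = D v * (?w \<bullet> x)" for v
    using W_grad_identity[OF x y, of v] by (simp only: mult_zero_right add_0)
  then show ?thesis
    by (intro has_derivative_eq_rhs[OF W'] ext) (simp only: inner_commute[of "?d _" ?w] mult_2 distrib_right)
qed

text \<open>Since \<open>c\<close> and \<open>W\<close> are independent of the direction,
  \<open>D\<close> is the same for all directions and so is the x-derivative of \<open>W\<close>.
  For a direction \<open>p\<close> orthogonal to \<open>x\<close> and for the direction
  \<open>x\<close> itself these derivatives differ by 2 \<open>D v\<close> \<bar>x\<bar>^2 /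
  \<open>F x x\<close>, so \<open>D\<close> vanishes. The direction \<open>x\<close> is admissible
  only if \<open>x \<noteq> 0\<close>.\<close>

lemma dual_factor_derivative_zero:
  assumes x: "x \<in> \<Omega>" "x \<noteq> 0" and y: "y \<noteq> 0"
  shows "((\<lambda>x. dual_factor x y) has_derivative (\<lambda>v. 0)) (at x)"
proof -
  obtain p where p: "p \<noteq> 0" "x \<bullet> p = 0" using orthogonal_vector .
  obtain D where D: "((\<lambda>x. dual_factor x p) has_derivative D) (at x)"
    using dual_factor_differentiable_x[OF x(1) p(1)] .
  have D': "((\<lambda>x. dual_factor x q) has_derivative D) (at x)" if "q \<noteq> 0" for q
    by (rule has_derivative_transform_within_open[OF D open_domain x(1)])
      (rule dual_factor_const[OF dim dflat pflat _ p(1) that])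
  have "((\<lambda>z. W z x) has_derivative
    (\<lambda>v. 2 * D v * ((inverse (F x p) *\<^sub>R p + dual_factor x p *\<^sub>R x) \<bullet> x))) (at x)"
    by (rule has_derivative_transform_within_open[OF W_has_derivative_x[OF x(1) p(1) D] open_domain x(1)])
      (rule W_const_y, use x p in auto)
  then have "(\<lambda>v. 2 * D v * ((inverse (F x p) *\<^sub>R p + dual_factor x p *\<^sub>R x) \<bullet> x)) =
      (\<lambda>v. 2 * D v * ((inverse (F x x) *\<^sub>R x + dual_factor x x *\<^sub>R x) \<bullet> x))"
    using W_has_derivative_x[OF x D'[OF x(2)]] has_derivative_unique by blast
  then have "2 * D v * ((inverse (F x p) *\<^sub>R p + dual_factor x p *\<^sub>R x) \<bullet> x) =
      2 * D v * ((inverse (F x x) *\<^sub>R x + dual_factor x x *\<^sub>R x) \<bullet> x)" for v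
    by (rule fun_cong)
  moreover have "dual_factor x p = dual_factor x x"
    by (rule dual_factor_const[OF dim dflat pflat x(1) p(1) x(2)])
  moreover have "p \<bullet> x = 0" using p(2) by (simp add: inner_commute)
  ultimately have "2 * D v * (inverse (F x x) * (x \<bullet> x)) = 0" for v
    unfolding inner_add_left inner_scaleR_left by (simp add: distrib_left)
  then have "D = (\<lambda>v. 0)" using F_pos[OF x] x(2) by (auto simp: fun_eq_iff)
  then show ?thesis using D'[OF y] by simp
qed

lemma dual_factor_W_constant:
  obtains c k where "\<And>x y. x \<in> \<Omega> \<Longrightarrow> y \<noteq> 0 \<Longrightarrow> dual_factor x y = c"
    "\<And>x y. x \<in> \<Omega> \<Longrightarrow> y \<noteq> 0 \<Longrightarrow> W x y = k"
proof (cases "\<Omega> = {}")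
  case False
  then obtain a where a: "a \<in> \<Omega>" by blast
  obtain p :: "real^'n" where p: "p \<noteq> 0" using orthogonal_vector by blast
  have c: "dual_factor x p = dual_factor a p" if "x \<in> \<Omega>" for x
  \<comment> \<open>This version tolerates the finite exceptional set \<open>{0}\<close>, provided
    the function is continuous there.\<close>
  proof (rule has_derivative_zero_unique_strong_convex[OF convex_domain, where K="{0}" and f="\<lambda>x. dual_factor x p" and c=a])
    have "(\<lambda>x. dual_factor x p) differentiable at x" if "x \<in> \<Omega>" for x
      using dual_factor_differentiable_x[OF that p] by (auto simp: differentiable_def)
    then show "continuous_on \<Omega> (\<lambda>x. dual_factor x p)"
      by (meson continuous_at_imp_continuous_on differentiable_imp_continuous_within)
    show "((\<lambda>x. dual_factor x p) has_derivative (\<lambda>h. 0)) (at x within \<Omega>)" if "x \<in> \<Omega> - {0}" for x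
      using dual_factor_derivative_zero[of x p] that p by (auto intro: has_derivative_at_withinI)
  qed (use a that in auto)
  \<comment> \<open>With \<open>c\<close> known to be constant, its derivative vanishes at the
    origin too, so \<open>W\<close> is covered without an exceptional point.\<close>
  have D0: "((\<lambda>x. dual_factor x p) has_derivative (\<lambda>h. 0)) (at x)" if "x \<in> \<Omega>" for x
    by (rule has_derivative_transform_within_open[OF has_derivative_const open_domain that]) (simp add: c)
  have k: "W x p = W a p" if "x \<in> \<Omega>" for x
  proof (rule has_derivative_zero_unique[where f="\<lambda>x. W x p", OF convex_domain _ that a])
    show "((\<lambda>x. W x p) has_derivative (\<lambda>h. 0)) (at x within \<Omega>)" if "x \<in> \<Omega>" for x
      using W_has_derivative_x[OF that p D0[OF that]] by (simp add: has_derivative_at_withinI)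
  qed
  show ?thesis
  proof (rule that)
    fix x y :: "real^'n" assume "x \<in> \<Omega>" "y \<noteq> 0"
    then show "dual_factor x y = dual_factor a p" "W x y = W a p"
      using c k dual_factor_const[OF dim dflat pflat _ _ p] W_const_y[OF _ _ p] by metis+
  qed
qed (use that in auto)

lemma flat_imp_funk_type:
  obtains k c where "\<And>x y. x \<in> \<Omega> \<Longrightarrow> y \<noteq> 0 \<Longrightarrow>
    0 < k - c\<^sup>2 * (norm x)\<^sup>2 \<and>
    F x y = (sqrt ((k - c\<^sup>2 * (norm x)\<^sup>2) * (norm y)\<^sup>2 + c\<^sup>2 * (x \<bullet> y)\<^sup>2) + c * (x \<bullet> y)) / (k - c\<^sup>2 * (norm x)\<^sup>2)"
proof -
  obtain c k where c: "\<And>x y. x \<in> \<Omega> \<Longrightarrow> y \<noteq> 0 \<Longrightarrow> dual_factor x y = c"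
    and k: "\<And>x y. x \<in> \<Omega> \<Longrightarrow> y \<noteq> 0 \<Longrightarrow> W x y = k"
    using dual_factor_W_constant by blast
  show ?thesis
  proof (rule that[of k c])
    fix x y :: "real^'n" assume x: "x \<in> \<Omega>" and y: "y \<noteq> 0"
    \<comment> \<open>Expanding \<open>W = k\<close> and multiplying by \<open>F\<^sup>2\<close>
      gives the quadratic equation for \<open>F\<close>; \<open>K\<close> is its leading
      coefficient.\<close>
    define K where "K = k - c\<^sup>2 * (norm x)\<^sup>2"
    have quad: "K * (F x y)\<^sup>2 = 2 * c * (x \<bullet> y) * F x y + (norm y)\<^sup>2" if y: "y \<noteq> 0" for y
    proof -
      note pos = F_pos[OF x y]
      have "k = (inverse (F x y))\<^sup>2 * (norm y)\<^sup>2 + 2 * inverse (F x y) * c * (x \<bullet> y) + c\<^sup>2 * (norm x)\<^sup>2"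
        using k[OF x y] unfolding W_def c[OF x y] power2_norm_eq_inner
        by (simp add: inner_add_left inner_add_right inner_commute power2_eq_square algebra_simps)
      then show ?thesis using pos by (simp add: K_def field_simps power2_eq_square)
    qed
    have K: "0 < K"
    proof -
      \<comment> \<open>Orthogonality removes the linear term, leaving
        \<open>K F\<^sup>2 = (norm p)\<^sup>2\<close>, which shows the sign of
        \<open>K\<close>.\<close>
      obtain p where p: "p \<noteq> 0" "x \<bullet> p = 0" using orthogonal_vector .
      have "0 < K * (F x p)\<^sup>2" using quad[OF p(1)] p by simp
      then show ?thesis using zero_less_mult_pos2 F_pos[OF x p(1)] by (simp add: zero_less_mult_iff)
    qed
    note pos = F_pos[OF x y]
    let ?v = "c * (x \<bullet> y)"
    have sq: "(K * F x y - ?v)\<^sup>2 = K * (norm y)\<^sup>2 + c\<^sup>2 * (x \<bullet> y)\<^sup>2"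
      using arg_cong[OF quad[OF y], of "\<lambda>t. K * t"] by (simp add: power2_eq_square algebra_simps)
    have "0 < K * (norm y)\<^sup>2" using K y by simp
    then have "(K * F x y - ?v)\<^sup>2 > ?v\<^sup>2" unfolding sq by (simp add: power_mult_distrib)
    \<comment> \<open>Selects the root: if \<open>K F - ?v\<close> were negative,
      \<open>K F > 0\<close> would make its absolute value smaller than
      \<bar>\<open>?v\<close>\<bar>.\<close>
    then have "\<bar>?v\<bar> < \<bar>K * F x y - ?v\<bar>" by (simp add: abs_le_square_iff flip: not_le)
    moreover have "0 < K * F x y" using K pos by simp
    ultimately have "0 \<le> K * F x y - ?v" by linarith
    then have "K * F x y - ?v = sqrt (K * (norm y)\<^sup>2 + c\<^sup>2 * (x \<bullet> y)\<^sup>2)"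
      unfolding sq[symmetric] by simp
    then have "F x y = (sqrt (K * (norm y)\<^sup>2 + c\<^sup>2 * (x \<bullet> y)\<^sup>2) + ?v) / K"
      using K by (simp add: field_simps)
    with K show "0 < k - c\<^sup>2 * (norm x)\<^sup>2 \<and>
      F x y = (sqrt ((k - c\<^sup>2 * (norm x)\<^sup>2) * (norm y)\<^sup>2 + c\<^sup>2 * (x \<bullet> y)\<^sup>2) + c * (x \<bullet> y)) / (k - c\<^sup>2 * (norm x)\<^sup>2)"
      unfolding K_def by simp
  qed
qed

end

section \<open>Converse: Funk-type metrics are flat in both senses\<close>

context
  fixes k c :: real
  assumes funk: "\<And>x y. x \<in> \<Omega> \<Longrightarrow> y \<noteq> 0 \<Longrightarrow> k - c\<^sup>2 * (norm x)\<^sup>2 \<noteq> 0 \<and>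
    0 \<le> (k - c\<^sup>2 * (norm x)\<^sup>2) * (norm y)\<^sup>2 + c\<^sup>2 * (x \<bullet> y)\<^sup>2 \<and>
    F x y = (sqrt ((k - c\<^sup>2 * (norm x)\<^sup>2) * (norm y)\<^sup>2 + c\<^sup>2 * (x \<bullet> y)\<^sup>2) + c * (x \<bullet> y)) / (k - c\<^sup>2 * (norm x)\<^sup>2)"
begin

text \<open>In a direction orthogonal to \<open>x\<close> the radicand is the coefficient times a
  positive number, so a nonnegative radicand and a nonzero coefficient leave only the positive
  sign.\<close>

lemma funk_coefficient_pos:
  assumes x: "x \<in> \<Omega>"
  shows "0 < k - c\<^sup>2 * (x \<bullet> x)"
proof -
  obtain p where p: "p \<noteq> 0" "x \<bullet> p = 0" using orthogonal_vector .
  have "k - c\<^sup>2 * (norm x)\<^sup>2 \<noteq> 0" "0 \<le> (k - c\<^sup>2 * (norm x)\<^sup>2) * (norm p)\<^sup>2"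
    using funk[OF x p(1)] p(2) by auto
  moreover have "0 < (norm p)\<^sup>2" using p(1) by simp
  ultimately have "0 < k - c\<^sup>2 * (norm x)\<^sup>2" by (auto simp: zero_le_mult_iff)
  then show ?thesis by (simp add: power2_norm_eq_inner)
qed

text \<open>The quantity is half the derivative of the quadratic equation with respect to
  \<open>F\<close>; its positivity makes implicit differentiation solvable for the
  gradients.\<close>

lemma funk_root_pos:
  assumes x: "x \<in> \<Omega>" and y: "y \<noteq> 0"
  shows "0 < (k - c\<^sup>2 * (x \<bullet> x)) * F x y - c * (x \<bullet> y)"
    and "((k - c\<^sup>2 * (x \<bullet> x)) * F x y - c * (x \<bullet> y))\<^sup>2 = (k - c\<^sup>2 * (x \<bullet> x)) * (y \<bullet> y) + c\<^sup>2 * (x \<bullet> y)\<^sup>2"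
proof -
  let ?K = "k - c\<^sup>2 * (x \<bullet> x)"
  have K: "0 < ?K" by (rule funk_coefficient_pos[OF x])
  have eq: "?K * F x y - c * (x \<bullet> y) = sqrt (?K * (y \<bullet> y) + c\<^sup>2 * (x \<bullet> y)\<^sup>2)"
    using funk[OF x y] K by (simp add: power2_norm_eq_inner)
  have "0 < ?K * (y \<bullet> y)" using K y by simp
  then have "0 < ?K * (y \<bullet> y) + c\<^sup>2 * (x \<bullet> y)\<^sup>2" by (rule add_pos_nonneg) simp
  then show "0 < ?K * F x y - c * (x \<bullet> y)"
    "(?K * F x y - c * (x \<bullet> y))\<^sup>2 = ?K * (y \<bullet> y) + c\<^sup>2 * (x \<bullet> y)\<^sup>2"
    unfolding eq by simp_all
qed

lemma funk_quadratic:
  assumes x: "x \<in> \<Omega>" and y: "y \<noteq> 0"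
  shows "(k - c\<^sup>2 * (x \<bullet> x)) * (F x y * F x y) - 2 * c * ((x \<bullet> y) * F x y) - y \<bullet> y = 0"
proof -
  let ?K = "k - c\<^sup>2 * (x \<bullet> x)"
  have "?K * (?K * (F x y * F x y) - 2 * c * ((x \<bullet> y) * F x y) - y \<bullet> y) = 0"
    using funk_root_pos(2)[OF x y] by (simp add: power2_eq_square algebra_simps)
  then show ?thesis using funk_coefficient_pos[OF x] by simp
qed

text \<open>Implicit differentiation gives \<open>?s F\<^sub>y = y + c F x\<close> and
  \<open>?s F\<^sub>x = c F (y + c F x)\<close>, with the same nonzero factor and the same
  vector.\<close>

lemma funk_grad:
  assumes x: "x \<in> \<Omega>" and y: "y \<noteq> 0"
  shows "grad_x F x y = (c * F x y) *\<^sub>R grad_y F x y"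
proof -
  let ?K = "k - c\<^sup>2 * (x \<bullet> x)" and ?s = "(k - c\<^sup>2 * (x \<bullet> x)) * F x y - c * (x \<bullet> y)"
  have "((\<lambda>x. (k - c\<^sup>2 * (x \<bullet> x)) * (F x y * F x y) - 2 * c * ((x \<bullet> y) * F x y) - y \<bullet> y) has_derivative
     (\<lambda>v. (?K * (F x y * (grad_x F x y \<bullet> v) + (grad_x F x y \<bullet> v) * F x y) + (0 - c\<^sup>2 * (x \<bullet> v + v \<bullet> x)) * (F x y * F x y))
       - 2 * c * ((x \<bullet> y) * (grad_x F x y \<bullet> v) + (v \<bullet> y) * F x y) - 0)) (at x)"
    by (intro has_derivative_diff has_derivative_mult has_derivative_mult_right has_derivative_const
        has_derivative_inner has_derivative_ident F_has_derivative(2) x y has_derivative_inner_left)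
  then have "((\<lambda>x. 0) has_derivative
     (\<lambda>v. (?K * (F x y * (grad_x F x y \<bullet> v) + (grad_x F x y \<bullet> v) * F x y) + (0 - c\<^sup>2 * (x \<bullet> v + v \<bullet> x)) * (F x y * F x y))
       - 2 * c * ((x \<bullet> y) * (grad_x F x y \<bullet> v) + (v \<bullet> y) * F x y) - 0)) (at x)"
    by (rule has_derivative_transform_within_open[OF _ open_domain x]) (rule funk_quadratic[OF _ y])
  note DX = fun_cong[OF has_derivative_unique[OF this has_derivative_const]]
  have X: "?s * (grad_x F x y \<bullet> v) = c * F x y * ((y + (c * F x y) *\<^sub>R x) \<bullet> v)" for v
    using DX[of v] by (simp add: inner_add_left inner_commute[of v] algebra_simps power2_eq_square)
  have "((\<lambda>y. ?K * (F x y * F x y) - 2 * c * ((x \<bullet> y) * F x y) - y \<bullet> y) has_derivative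
     (\<lambda>v. ?K * (F x y * (grad_y F x y \<bullet> v) + (grad_y F x y \<bullet> v) * F x y)
       - 2 * c * ((x \<bullet> y) * (grad_y F x y \<bullet> v) + (x \<bullet> v) * F x y) - (y \<bullet> v + v \<bullet> y))) (at y)"
    by (intro has_derivative_diff has_derivative_mult has_derivative_mult_right has_derivative_const
        has_derivative_inner has_derivative_ident F_has_derivative(3) x y has_derivative_inner_right)
  then have "((\<lambda>y. 0) has_derivative
     (\<lambda>v. ?K * (F x y * (grad_y F x y \<bullet> v) + (grad_y F x y \<bullet> v) * F x y)
       - 2 * c * ((x \<bullet> y) * (grad_y F x y \<bullet> v) + (x \<bullet> v) * F x y) - (y \<bullet> v + v \<bullet> y))) (at y)"
    by (rule has_derivative_transform_within_open[of _ _ _ _ "- {0}"]) (use y funk_quadratic[OF x] in auto)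
  note DY = fun_cong[OF has_derivative_unique[OF this has_derivative_const]]
  have Y: "?s * (grad_y F x y \<bullet> v) = (y + (c * F x y) *\<^sub>R x) \<bullet> v" for v
    using DY[of v] by (simp add: inner_add_left inner_commute[of v] algebra_simps power2_eq_square)
  have "?s * (grad_x F x y \<bullet> v) = ?s * (((c * F x y) *\<^sub>R grad_y F x y) \<bullet> v)" for v
    using X[of v] Y[of v] by (simp add: mult.left_commute)
  then have "grad_x F x y \<bullet> v = ((c * F x y) *\<^sub>R grad_y F x y) \<bullet> v" for v
    using funk_root_pos(1)[OF x y] by (metis less_irrefl mult_left_cancel)
  then show ?thesis using vector_eq_rdot by blast
qed

lemma funk_L0:
  assumes x: "x \<in> \<Omega>" and y: "y \<noteq> 0"
  shows "L0 x y = 2 * c * (F x y * (F x y * F x y))"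
  unfolding L0_eq[OF x y] grad_L[OF x y] funk_grad[OF x y]
  by (simp add: euler_F[OF x y])

text \<open>The coefficient is 6 - 4: \<open>L0 = 2 c F ^ 3\<close> contributes 6, and twice
  \<open>grad_x L\<close> takes away 4.\<close>

lemma funk_spray_covector:
  assumes x: "x \<in> \<Omega>" and y: "y \<noteq> 0"
  shows "grad_y L0 x y - 2 *\<^sub>R grad_x L x y = (2 * c * (F x y)\<^sup>2) *\<^sub>R grad_y F x y"
proof -
  have "((\<lambda>y. 2 * c * (F x y * (F x y * F x y))) has_derivative (\<lambda>v. ((6 * c * (F x y)\<^sup>2) *\<^sub>R grad_y F x y) \<bullet> v)) (at y)"
    by (rule has_derivative_eq_rhs[OF has_derivative_mult_right[OF has_derivative_mult[OF F_has_derivative(3)[OF x y]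
            has_derivative_mult[OF F_has_derivative(3)[OF x y] F_has_derivative(3)[OF x y]]]]])
      (auto simp: fun_eq_iff algebra_simps power2_eq_square)
  then have "(L0 x has_derivative (\<lambda>v. ((6 * c * (F x y)\<^sup>2) *\<^sub>R grad_y F x y) \<bullet> v)) (at y)"
    by (rule has_derivative_transform_within_open[of _ _ _ _ "- {0}"]) (use y funk_L0[OF x] in auto)
  then have 1: "grad_y L0 x y = (6 * c * (F x y)\<^sup>2) *\<^sub>R grad_y F x y" by (rule grad_y_eqI)
  show ?thesis unfolding 1 grad_L[OF x y] funk_grad[OF x y]
    by (simp add: power2_eq_square mult.left_commute flip: scaleR_diff_left)
qed

lemma funk_spray:
  assumes x: "x \<in> \<Omega>" and y: "y \<noteq> 0"
  shows "spray F x y = (c / 2 * F x y) *\<^sub>R y"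
proof (rule tensor_inj[OF x y])
  show "fundamental_tensor F x y *v spray F x y = fundamental_tensor F x y *v ((c / 2 * F x y) *\<^sub>R y)"
    unfolding tensor_spray[OF x y] funk_spray_covector[OF x y]
    unfolding matrix_vector_mult_scaleR tensor_mult_self[OF x y] grad_L[OF x y]
    by (simp add: power2_eq_square)
qed

lemma funk_projectively_flat: "projectively_flat_on \<Omega> F"
  unfolding projectively_flat_on_def
proof (intro allI impI)
  fix a b :: real and cv assume ab: "a < b" and "geodesic_on \<Omega> F a b cv"
  then obtain cv' where g: "\<And>t. t \<in> {a<..<b} \<Longrightarrow> cv t \<in> \<Omega> \<and> cv' t \<noteq> 0 \<and>
        (cv has_vector_derivative cv' t) (at t) \<and>
        (cv' has_vector_derivative (- 2 *\<^sub>R spray F (cv t) (cv' t))) (at t)"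
    unfolding geodesic_on_def by blast
  show "\<exists>p v. v \<noteq> 0 \<and> cv ` {a<..<b} \<subseteq> range (\<lambda>s. p + s *\<^sub>R v)"
  \<comment> \<open>The factor is -2 times the coefficient \<open>c / 2 * F\<close> of the
    spray.\<close>
  proof (rule straight_geodesic[OF _ ab, of cv' cv "\<lambda>t. - c * F (cv t) (cv' t)"])
    fix t assume "t \<in> {a<..<b}"
    from g[OF this] show "cv' t \<noteq> 0 \<and> (cv has_vector_derivative cv' t) (at t) \<and>
      (cv' has_vector_derivative (- c * F (cv t) (cv' t)) *\<^sub>R cv' t) (at t)"
      using funk_spray[of "cv t" "cv' t"] by simp
  qed
qed

lemma funk_locally_dually_flat: "locally_dually_flat_on \<Omega> F"
  unfolding locally_dually_flat_on_def
proof (intro ballI exI conjI allI impI)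
  \<comment> \<open>The lowered spray is \<open>(c / 2) F\<^sup>2 F\<^sub>y\<close>, so the dual
    equation demands \<open>H\<^sub>y = - c F\<^sup>2 F\<^sub>y\<close>, which integrates to this
    cubic. The neighbourhood is all of \<open>\<Omega>\<close> and the degree is 3.\<close>
  let ?H = "\<lambda>x y. (- c / 3) * (F x y * (F x y * F x y))"
  have "smooth_on (\<lambda>z. (- c / 3) * ((\<lambda>(x, y). F x y) z * ((\<lambda>(x, y). F x y) z * (\<lambda>(x, y). F x y) z))) (slit \<Omega>)"
    by (intro smooth_on_mult smooth_on_const smooth_F open_slit_domain)
  then show "smooth_on (\<lambda>(x, y). ?H x y) (slit \<Omega>)" by (simp add: case_prod_unfold)
  fix x y :: "real^'n" assume x: "x \<in> \<Omega>" and y: "y \<noteq> 0"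
  show "?H x (l *\<^sub>R y) = l powr 3 * ?H x y" if "l > 0" for l
    using that x by (simp add: F_hom power3_eq_cube)
  have "(?H x has_derivative (\<lambda>v. (- c * (F x y)\<^sup>2) *\<^sub>R grad_y F x y \<bullet> v)) (at y)"
    by (rule has_derivative_eq_rhs[OF has_derivative_mult_right[OF has_derivative_mult[OF F_has_derivative(3)[OF x y]
            has_derivative_mult[OF F_has_derivative(3)[OF x y] F_has_derivative(3)[OF x y]]]]])
      (auto simp: fun_eq_iff algebra_simps power2_eq_square)
  then have H: "grad_y ?H x y = (- c * (F x y)\<^sup>2) *\<^sub>R grad_y F x y" by (rule grad_y_eqI)
  have "fundamental_tensor F x y *v (- (1/2) *\<^sub>R (inv_tensor F x y *v grad_y ?H x y)) =
      fundamental_tensor F x y *v spray F x y"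
    unfolding tensor_spray[OF x y] funk_spray_covector[OF x y] matrix_vector_mult_scaleR tensor_inv[OF x y] H
    by simp
  then have "spray F x y = - (1/2) *\<^sub>R (inv_tensor F x y *v grad_y ?H x y)"
    by (rule tensor_inj[OF x y, symmetric])
  then show "spray F x y $ i = - (1/2) * (\<Sum>j\<in>UNIV. inv_tensor F x y $ i $ j * Dy j ?H x y)" for i
    by (simp add: matrix_vector_mult_def grad_component)
qed (use open_domain in auto)

end

end

theorem theorem1p1:
  fixes \<Omega> :: "(real^'n::finite) set"
    and F :: "real^'n \<Rightarrow> real^'n \<Rightarrow> real"
    and \<phi> :: "real \<Rightarrow> real \<Rightarrow> real \<Rightarrow> real"
  assumes "CARD('n) \<ge> 2"
    and "open \<Omega>" "convex \<Omega>" "\<Omega> \<noteq> {}"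
    and "finsler_metric_on \<Omega> F"
    and "spherically_symmetric_on \<Omega> F"
    and "\<And>x y. x \<in> \<Omega> \<Longrightarrow> y \<noteq> 0 \<Longrightarrow> F x y = \<phi> (norm x) (norm y) (x \<bullet> y)"
  shows "projectively_flat_on \<Omega> F \<and> locally_dually_flat_on \<Omega> F \<longleftrightarrow>
    (\<exists>k c :: real. \<forall>x\<in>\<Omega>. \<forall>y. y \<noteq> 0 \<longrightarrow>
      (let r = norm x; u = norm y; v = x \<bullet> y in
        k - c\<^sup>2 * r\<^sup>2 \<noteq> 0 \<and> 0 \<le> (k - c\<^sup>2 * r\<^sup>2) * u\<^sup>2 + c\<^sup>2 * v\<^sup>2 \<and>
        \<phi> r u v = (sqrt ((k - c\<^sup>2 * r\<^sup>2) * u\<^sup>2 + c\<^sup>2 * v\<^sup>2) + c * v) / (k - c\<^sup>2 * r\<^sup>2)))"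
proof -
  interpret spherical_finsler_domain \<Omega> F \<phi>
    by unfold_locales (use assms in auto)
  show ?thesis
  proof (intro iffI; (elim exE conjE)?)
    assume "projectively_flat_on \<Omega> F" "locally_dually_flat_on \<Omega> F"
    then obtain k c where kc: "\<And>x y. x \<in> \<Omega> \<Longrightarrow> y \<noteq> 0 \<Longrightarrow>
      0 < k - c\<^sup>2 * (norm x)\<^sup>2 \<and>
      F x y = (sqrt ((k - c\<^sup>2 * (norm x)\<^sup>2) * (norm y)\<^sup>2 + c\<^sup>2 * (x \<bullet> y)\<^sup>2) + c * (x \<bullet> y)) / (k - c\<^sup>2 * (norm x)\<^sup>2)"
      using flat_imp_funk_type by blast
    show "\<exists>k c :: real. \<forall>x\<in>\<Omega>. \<forall>y. y \<noteq> 0 \<longrightarrow>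
      (let r = norm x; u = norm y; v = x \<bullet> y in
        k - c\<^sup>2 * r\<^sup>2 \<noteq> 0 \<and> 0 \<le> (k - c\<^sup>2 * r\<^sup>2) * u\<^sup>2 + c\<^sup>2 * v\<^sup>2 \<and>
        \<phi> r u v = (sqrt ((k - c\<^sup>2 * r\<^sup>2) * u\<^sup>2 + c\<^sup>2 * v\<^sup>2) + c * v) / (k - c\<^sup>2 * r\<^sup>2))"
      unfolding Let_def
    proof (rule exI[of _ k], rule exI[of _ c], intro ballI allI impI conjI)
      fix x y :: "real^'n" assume xy: "x \<in> \<Omega>" "y \<noteq> 0"
      note kc[OF xy]
      then show "k - c\<^sup>2 * (norm x)\<^sup>2 \<noteq> 0"
        "\<phi> (norm x) (norm y) (x \<bullet> y) = (sqrt ((k - c\<^sup>2 * (norm x)\<^sup>2) * (norm y)\<^sup>2 + c\<^sup>2 * (x \<bullet> y)\<^sup>2) + c * (x \<bullet> y)) / (k - c\<^sup>2 * (norm x)\<^sup>2)"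
        using F_phi[OF xy] by auto
      show "0 \<le> (k - c\<^sup>2 * (norm x)\<^sup>2) * (norm y)\<^sup>2 + c\<^sup>2 * (x \<bullet> y)\<^sup>2"
        using kc[OF xy] by (intro add_nonneg_nonneg mult_nonneg_nonneg) auto
    qed
  next
    fix k c :: real
    assume kc: "\<forall>x\<in>\<Omega>. \<forall>y. y \<noteq> 0 \<longrightarrow>
      (let r = norm x; u = norm y; v = x \<bullet> y in
        k - c\<^sup>2 * r\<^sup>2 \<noteq> 0 \<and> 0 \<le> (k - c\<^sup>2 * r\<^sup>2) * u\<^sup>2 + c\<^sup>2 * v\<^sup>2 \<and>
        \<phi> r u v = (sqrt ((k - c\<^sup>2 * r\<^sup>2) * u\<^sup>2 + c\<^sup>2 * v\<^sup>2) + c * v) / (k - c\<^sup>2 * r\<^sup>2))"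
    have "k - c\<^sup>2 * (norm x)\<^sup>2 \<noteq> 0 \<and>
      0 \<le> (k - c\<^sup>2 * (norm x)\<^sup>2) * (norm y)\<^sup>2 + c\<^sup>2 * (x \<bullet> y)\<^sup>2 \<and>
      F x y = (sqrt ((k - c\<^sup>2 * (norm x)\<^sup>2) * (norm y)\<^sup>2 + c\<^sup>2 * (x \<bullet> y)\<^sup>2) + c * (x \<bullet> y)) / (k - c\<^sup>2 * (norm x)\<^sup>2)"
      if "x \<in> \<Omega>" "y \<noteq> 0" for x y :: "real^'n"
      using kc[rule_format, OF that] F_phi[OF that] by (simp add: Let_def)
    note funk_projectively_flat[OF this] funk_locally_dually_flat[OF this]
    then show "projectively_flat_on \<Omega> F \<and> locally_dually_flat_on \<Omega> F" by blast
  qed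
qed

end
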